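(* Let $d=2$, let $a\ge 0$ be a constant and consider the non-negative operator $-\Delta_a:=-\Delta+\frac{a}{|x|^2}$. Then for all $\psi\in C_0^\infty(\mathbb{R}^2\setminus\{0\})$, $$\int_{\mathbb{R}^2}|-\Delta_a\psi(x)|^2\,dx\ \ge\ C_a\Bigg[\int_{\mathbb{R}^2}\frac{|\nabla\psi(x)|^2}{|x|^{2}}\,dx+a\int_{\mathbb{R}^2}\frac{|\psi(x)|^2}{|x|^{4}}\,dx\Bigg],$$ where $$C_a=\min_{k\in\mathbb{N}_0}\frac{(k^2+a-1)^2}{k^2+a+1}.$$
   Context: $\mathbb{N}_0=\{0,1,2,\dots\}$. Functions $\psi$ are complex-valued. *)

theory Defs
  imports "HOL-Analysis.Analysis"
begin

definition pderivative :: "'n::finite \<Rightarrow> (real^'n \<Rightarrow> complex) \<Rightarrow> real^'n \<Rightarrow> complex" where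
  "pderivative i f x = vector_derivative (\<lambda>t. f (x + t *\<^sub>R axis i 1)) (at 0)"

definition gradient :: "(real^'n::finite \<Rightarrow> complex) \<Rightarrow> real^'n \<Rightarrow> complex^'n" where
  "gradient f x = (\<chi> i. pderivative i f x)"

definition laplacian :: "(real^'n::finite \<Rightarrow> complex) \<Rightarrow> real^'n \<Rightarrow> complex" where
  "laplacian f x = (\<Sum>i\<in>UNIV. pderivative i (pderivative i f) x)"

(* C^\<infinity>: all iterated partial derivatives, of every order including 0, are (totally)
   differentiable. Continuity of all of them is then automatic. *)
definition smooth :: "(real^'n::finite \<Rightarrow> complex) \<Rightarrow> bool" where
  "smooth f \<longleftrightarrow> (\<forall>is. foldr pderivative is f differentiable_on UNIV)"

(* C_0^\<infinity>(U) for open U, its elements being identified with their extensions by zero to the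
   whole space; such an extension is smooth everywhere because the support is a compact subset
   of U. *)
definition test_functions :: "(real^'n::finite) set \<Rightarrow> (real^'n \<Rightarrow> complex) set" where
  "test_functions U = {f. smooth f \<and> compact (closure (support_on UNIV f)) \<and>
                          closure (support_on UNIV f) \<subseteq> U}"

(* -\<Delta> + a/|x|^2, acting pointwise; the value at the origin is immaterial for functions
   supported away from it. *)
definition neg_laplacian_inv_square :: "real \<Rightarrow> (real^'n::finite \<Rightarrow> complex) \<Rightarrow> real^'n \<Rightarrow> complex" where
  "neg_laplacian_inv_square a f x = - laplacian f x + of_real (a / norm x ^ 2) * f x"

definition hardy_rellich_ratio :: "real \<Rightarrow> nat \<Rightarrow> real" where
  "hardy_rellich_ratio a k = (real k ^ 2 + a - 1) ^ 2 / (real k ^ 2 + a + 1)"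

definition hardy_rellich_const :: "real \<Rightarrow> real" where
  "hardy_rellich_const a = (LEAST c. c \<in> range (hardy_rellich_ratio a))"

(* For a \<ge> 0 the minimum over all naturals exists, so the LEAST above is meaningful. *)
lemma hardy_rellich_const_is_minimum:
  assumes a: "a \<ge> 0"
  shows "hardy_rellich_const a \<in> range (hardy_rellich_ratio a)"
    and "hardy_rellich_const a \<le> hardy_rellich_ratio a k"
proof -
  let ?f = "hardy_rellich_ratio a"
  have lower: "?f k \<ge> real k ^ 2 - 4" for k
  proof -
    define s where "s = real k ^ 2 + a + 1"
    have s: "s \<ge> 1" using a by (simp add: s_def)
    have "(s - 4) * s \<le> (s - 2) ^ 2" by (simp add: power2_eq_square algebra_simps)
    then have "s - 4 \<le> (s - 2) ^ 2 / s" using s by (simp add: pos_le_divide_eq)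
    moreover have "?f k = (s - 2) ^ 2 / s" by (simp add: hardy_rellich_ratio_def s_def)
    ultimately show ?thesis using a by (simp add: s_def)
  qed
  obtain N :: nat where N: "real N \<ge> ?f 0 + 4" using real_arch_simple by blast
  define m where "m = Min (?f ` {..N})"
  have m_in: "m \<in> ?f ` {..N}" unfolding m_def by (rule Min_in) auto
  have m_le: "m \<le> ?f k" for k
  proof (cases "k \<le> N")
    case True
    then show ?thesis unfolding m_def by simp
  next
    case False
    then have "N \<le> k * k" by (metis le_square le_trans nat_le_linear)
    then have "real N \<le> real k ^ 2" by (metis of_nat_le_iff of_nat_mult power2_eq_square)
    then have "?f 0 \<le> ?f k" using N lower[of k] by linarith
    moreover have "m \<le> ?f 0" unfolding m_def by simp
    ultimately show ?thesis by simp
  qed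
  have "hardy_rellich_const a = m"
    unfolding hardy_rellich_const_def using m_in m_le by (intro Least_equality) auto
  then show "hardy_rellich_const a \<in> range ?f" "hardy_rellich_const a \<le> ?f k"
    using m_in m_le by auto
qed

end

theory Submission
  imports Defs
begin

text \<open>
  Let \<open>E = r \<partial>\<^sub>r\<close> be the Euler field and \<open>L = \<partial>\<^sub>\<theta>\<close> the rotation field, so that
  \<open>r\<^sup>2 \<Delta> = E\<^sup>2 + L\<^sup>2\<close> and \<open>r\<^sup>2 |\<nabla>\<psi>|\<^sup>2 = |E\<psi>|\<^sup>2 + |L\<psi>|\<^sup>2\<close>. For the inner product with weight
  \<open>r\<^sup>-\<^sup>4\<close> the operators \<open>D = E - 1\<close> and \<open>L\<close> are skew-symmetric and commute. Expanding
  \<open>E\<^sup>2 + L\<^sup>2 - a = D\<^sup>2 + 2 D + A\<close> with \<open>A = L\<^sup>2 + 1 - a\<close>, the left-hand side becomes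
  \<open>|D\<^sup>2\<psi>|\<^sup>2 + 2 |D L \<psi>|\<^sup>2 + (2 a + 2) |D\<psi>|\<^sup>2 + |A\<psi>|\<^sup>2\<close> and the bracket on the right
  \<open>|D\<psi>|\<^sup>2 + |L\<psi>|\<^sup>2 + (1 + a) |\<psi>|\<^sup>2\<close>. Since \<open>C \<le> a + 1\<close> by the mode \<open>k = 0\<close>, it remains to see
  \<open>|A\<psi>|\<^sup>2 \<ge> C (|L\<psi>|\<^sup>2 + (1 + a) |\<psi>|\<^sup>2)\<close>. This involves \<open>L\<close> only, so it follows by averaging over
  rotations from the corresponding inequality on the circle, which on the \<open>k\<close>-th Fourier mode reads
  \<open>(k\<^sup>2 + a - 1)\<^sup>2 \<ge> C (k\<^sup>2 + a + 1)\<close>.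
\<close>

section \<open>Partial derivatives of smooth functions\<close>

lemma smooth_pderivative: "smooth f \<Longrightarrow> smooth (pderivative i f)"
  unfolding smooth_def
proof
  fix js assume "\<forall>is. foldr pderivative is f differentiable_on UNIV"
  then have "foldr pderivative (js @ [i]) f differentiable_on UNIV" by blast
  then show "foldr pderivative js (pderivative i f) differentiable_on UNIV" by simp
qed

lemma smooth_imp_differentiable: "smooth f \<Longrightarrow> f differentiable (at x)"
  unfolding smooth_def differentiable_on_def by (drule spec[of _ "[]"]) simp

lemma smooth_imp_continuous_on: "smooth f \<Longrightarrow> continuous_on S f"
  by (meson continuous_at_imp_continuous_on differentiable_imp_continuous_within smooth_imp_differentiable)

text \<open>Membership in \<open>S\<close> propagates along any list of directions by induction on
  the list. Smoothness can then be proved by naming a class of functions closed under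
  \<open>pderivative\<close>, without a formula for iterated derivatives.\<close>

lemma smooth_coinduct:
  assumes "f \<in> S"
    and S: "\<And>f. f \<in> S \<Longrightarrow> f differentiable_on UNIV"
      "\<And>f i. f \<in> S \<Longrightarrow> pderivative i f \<in> S"
  shows "smooth f"
proof -
  have "foldr pderivative js f \<in> S" for js
    by (induction js) (use assms in auto)
  then show ?thesis
    unfolding smooth_def using S(1) by blast
qed

lemma pderivative_eqI:
  assumes "(f has_derivative f') (at x)"
  shows "pderivative i f x = f' (axis i 1)"
proof -
  interpret bounded_linear f' using assms by (rule has_derivative_bounded_linear)
  have "((\<lambda>t. x + t *\<^sub>R axis i 1) has_derivative (\<lambda>t. t *\<^sub>R axis i 1)) (at 0)"
    by (auto intro!: derivative_eq_intros)
  then have "((\<lambda>t. f (x + t *\<^sub>R axis i 1)) has_derivative (\<lambda>t. f' (t *\<^sub>R axis i 1))) (at 0)"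
    using assms by (intro has_derivative_compose[of _ _ 0 UNIV f]) auto
  then have "((\<lambda>t. f (x + t *\<^sub>R axis i 1)) has_vector_derivative f' (axis i 1)) (at 0)"
    by (simp add: has_vector_derivative_def scaleR)
  then show ?thesis
    unfolding pderivative_def by (rule vector_derivative_at)
qed

lemma has_derivative_pderivative:
  fixes f :: "real^'n \<Rightarrow> complex"
  assumes "f differentiable (at x)"
  shows "(f has_derivative (\<lambda>h. \<Sum>i\<in>UNIV. h $ i *\<^sub>R pderivative i f x)) (at x)"
proof -
  obtain f' where f': "(f has_derivative f') (at x)"
    using assms by (auto simp: differentiable_def)
  interpret bounded_linear f' using f' by (rule has_derivative_bounded_linear)
  have "f' h = (\<Sum>i\<in>UNIV. h $ i *\<^sub>R pderivative i f x)" for h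
  proof -
    have "f' h = f' (\<Sum>i\<in>UNIV. h $ i *\<^sub>R axis i 1)"
      by (simp only: basis_expansion[of h, unfolded scalar_mult_eq_scaleR])
    then show ?thesis
      by (simp add: sum scaleR pderivative_eqI[OF f'])
  qed
  then have "f' = (\<lambda>h. \<Sum>i\<in>UNIV. h $ i *\<^sub>R pderivative i f x)" by (rule ext)
  with f' show ?thesis by simp
qed

lemma has_vector_derivative_line:
  fixes f :: "real^'n \<Rightarrow> complex"
  assumes "f differentiable (at (x + t *\<^sub>R axis i 1))"
  shows "((\<lambda>t. f (x + t *\<^sub>R axis i 1)) has_vector_derivative
    pderivative i f (x + t *\<^sub>R axis i 1)) (at t within S)"
proof -
  obtain f' where f': "(f has_derivative f') (at (x + t *\<^sub>R axis i 1))"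
    using assms by (auto simp: differentiable_def)
  interpret bounded_linear f' using f' by (rule has_derivative_bounded_linear)
  have "((\<lambda>t. x + t *\<^sub>R axis i 1) has_derivative (\<lambda>t. t *\<^sub>R axis i 1)) (at t)"
    by (auto intro!: derivative_eq_intros)
  then have "((\<lambda>t. f (x + t *\<^sub>R axis i 1)) has_derivative (\<lambda>t. f' (t *\<^sub>R axis i 1))) (at t)"
    using f' by (intro has_derivative_compose[of _ _ t UNIV f]) auto
  then show ?thesis
    by (simp add: has_vector_derivative_def scaleR pderivative_eqI[OF f'] has_derivative_at_withinI)
qed

lemma pderivative_add:
  assumes "f differentiable (at x)" "g differentiable (at x)"
  shows "pderivative i (\<lambda>x. f x + g x) x = pderivative i f x + pderivative i g x"
proof -
  obtain f' g' where f': "(f has_derivative f') (at x)" and g': "(g has_derivative g') (at x)"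
    using assms by (auto simp: differentiable_def)
  show ?thesis
    by (simp add: pderivative_eqI[OF has_derivative_add[OF f' g']] pderivative_eqI[OF f']
        pderivative_eqI[OF g'])
qed

lemma pderivative_cmult:
  assumes "f differentiable (at x)"
  shows "pderivative i (\<lambda>x. c * f x) x = c * pderivative i f x"
proof -
  obtain f' where f': "(f has_derivative f') (at x)"
    using assms by (auto simp: differentiable_def)
  show ?thesis
    by (simp add: pderivative_eqI[OF has_derivative_mult_right[OF f']] pderivative_eqI[OF f'])
qed

lemma has_derivative_coordinate:
  "((\<lambda>x. of_real (x $ j) :: complex) has_derivative (\<lambda>h. of_real (h $ j))) (at (x :: real^'n))"
  by (intro bounded_linear_imp_has_derivative bounded_linear_compose[OF bounded_linear_of_real]
      bounded_linear_vec_nth)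

lemma pderivative_coordinate_mult:
  assumes "f differentiable (at x)"
  shows "pderivative i (\<lambda>x. of_real (x $ j) * f x) x =
    of_real (if i = j then 1 else 0) * f x + of_real (x $ j) * pderivative i f x"
proof -
  obtain f' where f': "(f has_derivative f') (at x)"
    using assms by (auto simp: differentiable_def)
  show ?thesis
    using pderivative_eqI[OF has_derivative_mult[OF has_derivative_coordinate f', of j], of i]
    by (auto simp: pderivative_eqI[OF f'] axis_def algebra_simps)
qed

lemma smooth_add:
  assumes "smooth f" "smooth g"
  shows "smooth (\<lambda>x. f x + g x)"
proof (rule smooth_coinduct)
  let ?S = "{h. \<exists>f g. smooth f \<and> smooth g \<and> h = (\<lambda>x. f x + g x)}"
  show "(\<lambda>x. f x + g x) \<in> ?S" using assms by blast
  show "h differentiable_on UNIV" if "h \<in> ?S" for h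
    using that smooth_imp_differentiable
    by (auto simp: differentiable_on_def intro!: differentiable_add)
  show "pderivative i h \<in> ?S" if "h \<in> ?S" for h i
    using that
    by (force intro!: ext smooth_pderivative pderivative_add smooth_imp_differentiable)
qed

lemma smooth_cmult:
  assumes "smooth f"
  shows "smooth (\<lambda>x. c * f x)"
proof (rule smooth_coinduct)
  let ?S = "{h. \<exists>f. smooth f \<and> h = (\<lambda>x. c * f x)}"
  show "(\<lambda>x. c * f x) \<in> ?S" using assms by blast
  show "h differentiable_on UNIV" if "h \<in> ?S" for h
    using that smooth_imp_differentiable
    by (auto simp: differentiable_on_def intro!: differentiable_mult)
  show "pderivative i h \<in> ?S" if "h \<in> ?S" for h i
    using that
    by (force intro!: ext smooth_pderivative pderivative_cmult smooth_imp_differentiable)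
qed

lemma differentiable_coordinate_mult:
  "f differentiable (at x) \<Longrightarrow> (\<lambda>x. complex_of_real (x $ j) * f x) differentiable (at x)"
  using has_derivative_coordinate by (intro differentiable_mult) (auto simp: differentiable_def)

lemma smooth_coordinate_mult:
  assumes "smooth f"
  shows "smooth (\<lambda>x. of_real (x $ j) * f x)"
proof (rule smooth_coinduct)
  \<comment> \<open>Multiples of the coordinate alone are not closed under differentiation: the
    product rule also differentiates the coordinate. The summand \<open>g\<close> absorbs the
    resulting term and starts as zero.\<close>
  let ?S = "{h. \<exists>f g. smooth f \<and> smooth g \<and> h = (\<lambda>x. of_real (x $ j) * f x + g x)}"
  have "smooth (\<lambda>x::real^'a. 0)"
    using smooth_cmult[OF assms, of 0] by simp
  then show "(\<lambda>x. of_real (x $ j) * f x) \<in> ?S" using assms by force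
  show "h differentiable_on UNIV" if "h \<in> ?S" for h
    using that smooth_imp_differentiable
    by (auto simp: differentiable_on_def intro!: differentiable_add differentiable_coordinate_mult)
  show "pderivative i h \<in> ?S" if "h \<in> ?S" for h i
  proof -
    obtain f g where fg: "smooth f" "smooth g" and h: "h = (\<lambda>x. of_real (x $ j) * f x + g x)"
      using \<open>h \<in> ?S\<close> by blast
    have "pderivative i h = (\<lambda>x. of_real (x $ j) * pderivative i f x +
        (of_real (if i = j then 1 else 0) * f x + pderivative i g x))"
      unfolding h using fg
      by (intro ext) (subst pderivative_add, auto simp: pderivative_coordinate_mult
        smooth_imp_differentiable differentiable_coordinate_mult)
    moreover have "smooth (\<lambda>x. of_real (if i = j then 1 else 0) * f x + pderivative i g x)"
      using fg by (intro smooth_add smooth_cmult smooth_pderivative)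
    ultimately show ?thesis using fg smooth_pderivative by blast
  qed
qed

text \<open>
  Differentiate \<open>f (x + s u + t v) = f (x + s u) + \<integral>\<^sub>0\<^sup>t \<partial>\<^sub>v f (x + s u + \<tau> v) d\<tau>\<close> in \<open>s\<close> under the
  integral sign, then in \<open>t\<close>.
\<close>

lemma pderivative_commute:
  fixes f :: "real^'n \<Rightarrow> complex"
  assumes f: "smooth f"
  shows "pderivative i (pderivative j f) x = pderivative j (pderivative i f) x"
proof -
  define u v where "u = (axis i 1 :: real^'n)" and "v = (axis j 1 :: real^'n)"
  note diff = smooth_imp_differentiable[OF f] smooth_imp_differentiable[OF smooth_pderivative[OF f]]
    smooth_imp_differentiable[OF smooth_pderivative[OF smooth_pderivative[OF f]]]
  have ftc: "((\<lambda>\<tau>. pderivative j f (y + \<tau> *\<^sub>R v)) has_integral (f (y + t *\<^sub>R v) - f y)) {0..t}"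
    if "t \<ge> 0" for t y
    using fundamental_theorem_of_calculus[OF that
      has_vector_derivative_line[of f y _ j "{0..t}", OF diff(1)]]
    by (simp add: v_def)
  have line: "((\<lambda>s. f (y + s *\<^sub>R u)) has_vector_derivative pderivative i f (y + s *\<^sub>R u)) (at s within S)" 
    if "smooth f" for f y s S
    unfolding u_def by (rule has_vector_derivative_line[OF smooth_imp_differentiable[OF that]])
  have eq: "integral {0..t} (\<lambda>\<tau>. pderivative i (pderivative j f) (x + \<tau> *\<^sub>R v)) =
      pderivative i f (x + t *\<^sub>R v) - pderivative i f x" if "t \<ge> 0" for t
  proof -
    have "((\<lambda>s. integral (cbox 0 t) (\<lambda>\<tau>. pderivative j f (x + \<tau> *\<^sub>R v + s *\<^sub>R u)))
        has_vector_derivative integral (cbox 0 t)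
        (\<lambda>\<tau>. pderivative i (pderivative j f) (x + \<tau> *\<^sub>R v + 0 *\<^sub>R u))) (at 0 within UNIV)"
      apply (rule leibniz_rule_vector_derivative
          [where fx = "\<lambda>s \<tau>. pderivative i (pderivative j f) (x + \<tau> *\<^sub>R v + s *\<^sub>R u)"])
      subgoal by (rule line) (rule smooth_pderivative[OF f])
      subgoal by (intro integrable_continuous continuous_on_compose2[OF
          smooth_imp_continuous_on[OF smooth_pderivative[OF f], of UNIV]] continuous_intros) auto
      subgoal by (simp add: split_beta) (intro continuous_on_compose2[OF
          smooth_imp_continuous_on[OF smooth_pderivative[OF smooth_pderivative[OF f]], of UNIV]]
          continuous_intros, auto)
      by auto
    moreover have "integral (cbox 0 t) (\<lambda>\<tau>. pderivative j f (x + \<tau> *\<^sub>R v + s *\<^sub>R u)) =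
        f (x + t *\<^sub>R v + s *\<^sub>R u) - f (x + s *\<^sub>R u)" for s
      using integral_unique[OF ftc[OF that, of "x + s *\<^sub>R u"]] by (simp add: algebra_simps)
    ultimately have "((\<lambda>s. f (x + t *\<^sub>R v + s *\<^sub>R u) - f (x + s *\<^sub>R u))
        has_vector_derivative integral {0..t}
        (\<lambda>\<tau>. pderivative i (pderivative j f) (x + \<tau> *\<^sub>R v))) (at 0)"
      by simp
    moreover have "((\<lambda>s. f (x + t *\<^sub>R v + s *\<^sub>R u) - f (x + s *\<^sub>R u))
        has_vector_derivative pderivative i f (x + t *\<^sub>R v + 0 *\<^sub>R u) - pderivative i f (x + 0 *\<^sub>R u)) (at 0)"
      by (intro has_vector_derivative_diff line f)
    ultimately show ?thesis
      by (simp add: vector_derivative_unique_at)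
  qed
  \<comment> \<open>Since \<open>eq\<close> holds for t \<ge> 0, the derivatives at 0 are taken from
    the right, within \<open>{0..1}\<close>, where they are still unique.\<close>
  have "((\<lambda>t. integral {0..t} (\<lambda>\<tau>. pderivative i (pderivative j f) (x + \<tau> *\<^sub>R v)))
      has_vector_derivative pderivative i (pderivative j f) (x + 0 *\<^sub>R v)) (at 0 within {0..1})"
    by (intro integral_has_vector_derivative continuous_on_compose2[OF
          smooth_imp_continuous_on[OF smooth_pderivative[OF smooth_pderivative[OF f]], of UNIV]]
          continuous_intros) auto
  then have "((\<lambda>t. pderivative i f (x + t *\<^sub>R v) - pderivative i f x)
      has_vector_derivative pderivative i (pderivative j f) (x + 0 *\<^sub>R v)) (at 0 within {0..1})"
    by (rule has_vector_derivative_transform_within[where d = 1]) (auto simp: eq)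
  moreover have "((\<lambda>t. pderivative i f (x + t *\<^sub>R v) - pderivative i f x)
      has_vector_derivative pderivative j (pderivative i f) (x + 0 *\<^sub>R v) - 0) (at 0 within {0..1})"
    unfolding v_def
    by (intro has_vector_derivative_diff has_vector_derivative_line diff has_vector_derivative_const)
  ultimately show ?thesis
    by (intro vector_derivative_unique_within_closed_interval[of 0 1 0]) auto
qed

section \<open>Functions supported in an annulus\<close>

text \<open>Bounds on the norm replace the closure of the support, so that stability under sums and
  derivatives and division by powers of \<open>norm x\<close> become elementary.\<close>

definition annular :: "('a::real_normed_vector \<Rightarrow> 'b::zero) \<Rightarrow> bool" where
  "annular f \<longleftrightarrow> (\<exists>r>0. \<exists>R. \<forall>x. f x \<noteq> 0 \<longrightarrow> r \<le> norm x \<and> norm x \<le> R)"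

lemma annular_mono:
  assumes "annular f" "\<And>x. f x = 0 \<Longrightarrow> g x = 0"
  shows "annular g"
  using assms unfolding annular_def by metis

lemma annular_add:
  fixes f g :: "'a::real_normed_vector \<Rightarrow> 'b::monoid_add"
  assumes "annular f" "annular g"
  shows "annular (\<lambda>x. f x + g x)"
proof -
  obtain r R r' R' where "r > 0" "r' > 0"
    "\<And>x. f x \<noteq> 0 \<Longrightarrow> r \<le> norm x \<and> norm x \<le> R"
    "\<And>x. g x \<noteq> 0 \<Longrightarrow> r' \<le> norm x \<and> norm x \<le> R'"
    using assms unfolding annular_def by metis
  then have "\<forall>x. f x + g x \<noteq> 0 \<longrightarrow> min r r' \<le> norm x \<and> norm x \<le> max R R'"
    by (metis add_0 max.coboundedI1 max.coboundedI2 min.coboundedI1 min.coboundedI2)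
  moreover have "min r r' > 0" using \<open>r > 0\<close> \<open>r' > 0\<close> by simp
  ultimately show ?thesis unfolding annular_def by blast
qed

text \<open>A compact set is bounded, and if it misses the origin, its open complement contains a
  ball around 0; this gives the two radii. Conversely the closed annulus contains the closure of the
  support.\<close>

lemma annular_iff_support:
  fixes f :: "'a::euclidean_space \<Rightarrow> 'b::monoid_add"
  shows "annular f \<longleftrightarrow> compact (closure (support_on UNIV f)) \<and> closure (support_on UNIV f) \<subseteq> UNIV - {0}"
    (is "_ \<longleftrightarrow> ?r")
proof
  assume "annular f"
  then obtain r R where "r > 0" and f: "\<And>x. f x \<noteq> 0 \<Longrightarrow> r \<le> norm x \<and> norm x \<le> R"
    unfolding annular_def by blast
  have "closure (support_on UNIV f) \<subseteq> {x. r \<le> norm x \<and> norm x \<le> R}"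
    using f by (intro closure_minimal closed_Collect_conj closed_Collect_le continuous_intros)
      (auto simp: support_on_def)
  moreover from this have "bounded (closure (support_on UNIV f))"
    by (auto intro!: boundedI[of _ R])
  ultimately show ?r
    using \<open>r > 0\<close> by (auto simp: compact_eq_bounded_closed)
next
  let ?K = "closure (support_on UNIV f)"
  assume r: ?r
  then obtain R where R: "\<And>x. x \<in> ?K \<Longrightarrow> norm x \<le> R"
    by (meson bounded_iff compact_imp_bounded)
  have "open (- ?K)" "0 \<in> - ?K" using r by auto
  then obtain r where "r > 0" "ball 0 r \<subseteq> - ?K"
    by (meson openE)
  then have "r \<le> norm x" if "x \<in> ?K" for x
    using that by (force simp: subset_iff)
  moreover have "x \<in> ?K" if "f x \<noteq> 0" for x
    using that closure_subset[of "support_on UNIV f"] by (auto simp: support_on_def)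
  ultimately show "annular f"
    unfolding annular_def using R \<open>r > 0\<close> by blast
qed

lemma test_functions_punctured:
  "f \<in> test_functions (UNIV - {0}) \<longleftrightarrow> smooth f \<and> annular f"
  unfolding test_functions_def annular_iff_support by simp

text \<open>Off the closed annulus, which has open complement, the function is locally zero and
  hence has zero derivative. The same radii therefore serve.\<close>

lemma annular_pderivative:
  fixes f :: "real^'n \<Rightarrow> complex"
  assumes "annular f"
  shows "annular (pderivative i f)"
proof -
  obtain r R where "r > 0" and f: "\<And>x. f x \<noteq> 0 \<Longrightarrow> r \<le> norm x \<and> norm x \<le> R"
    using assms unfolding annular_def by blast
  have "r \<le> norm x \<and> norm x \<le> R" if "pderivative i f x \<noteq> 0" for x
  proof (rule ccontr)
    assume *: "\<not> (r \<le> norm x \<and> norm x \<le> R)"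
    let ?S = "{y. norm y < r} \<union> {y. norm y > R} :: (real^'n) set"
    have "open ?S" 
      by (intro open_Un open_Collect_less continuous_intros)
    moreover have "x \<in> ?S" using * by auto
    moreover have "((\<lambda>_. 0) has_derivative (\<lambda>_. 0)) (at x)" by simp
    moreover have "0 = f y" if "y \<in> ?S" for y
      using f[of y] that by force
    ultimately have "(f has_derivative (\<lambda>_. 0)) (at x)"
      using has_derivative_transform_within_open by blast
    from pderivative_eqI[OF this] that show False by simp
  qed
  then show ?thesis using \<open>r > 0\<close> unfolding annular_def by blast
qed

lemma continuous_on_annular_div:
  fixes q :: "'a::real_normed_vector \<Rightarrow> real"
  assumes q: "continuous_on UNIV q" "annular q"
  shows "continuous_on UNIV (\<lambda>x. q x / norm x ^ n)"
proof -
  obtain r R where "r > 0" and nz: "\<And>x. q x \<noteq> 0 \<Longrightarrow> r \<le> norm x \<and> norm x \<le> R"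
    using q unfolding annular_def by blast
  \<comment> \<open>Truncating the norm from below at \<open>r\<close> changes nothing where
    \<open>q\<close> is nonzero and keeps the denominator away from 0; elsewhere both quotients are
    0.\<close>
  have eq: "(\<lambda>x. q x / norm x ^ n) = (\<lambda>x. q x / max r (norm x) ^ n)"
    using nz by (force simp: max_def)
  show ?thesis
    unfolding eq using \<open>r > 0\<close> by (intro continuous_intros q) (auto simp: max_def)
qed

lemma integrable_compact_support:
  fixes q :: "'a::euclidean_space \<Rightarrow> real"
  assumes "continuous_on UNIV q" "\<And>x. q x \<noteq> 0 \<Longrightarrow> norm x \<le> R"
  shows "integrable lborel q"
proof -
  have "integrable lborel (\<lambda>x. indicator (cball 0 R) x *\<^sub>R q x)"
    using assms by (intro borel_integrable_compact) (auto intro: continuous_on_subset)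
  also have "(\<lambda>x. indicator (cball 0 R) x *\<^sub>R q x) = q"
    using assms(2) by (force simp: indicator_def)
  finally show ?thesis .
qed

lemma integrable_annular_div:
  fixes q :: "'a::euclidean_space \<Rightarrow> real"
  assumes q: "continuous_on UNIV q" "annular q"
  shows "integrable lborel (\<lambda>x. q x / norm x ^ n)"
proof -
  obtain R where "\<And>x. q x \<noteq> 0 \<Longrightarrow> norm x \<le> R"
    using q unfolding annular_def by blast
  then show ?thesis
    using continuous_on_annular_div[OF q]
    by (intro integrable_compact_support[of _ R]) auto
qed

section \<open>Averaging over rotations and dilations\<close>

text \<open>Complex multiplication on the plane treats rotations and dilations at once.\<close>

definition cmul :: "complex \<Rightarrow> real^2 \<Rightarrow> real^2" where
  "cmul z x = vector [Re z * x$1 - Im z * x$2, Im z * x$1 + Re z * x$2]"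

lemma cmul_nth [simp]:
  "cmul z x $ 1 = Re z * x$1 - Im z * x$2" "cmul z x $ 2 = Im z * x$1 + Re z * x$2"
  by (simp_all add: cmul_def)

lemma norm_real2: "norm (x :: real^2) ^ 2 = (x$1)^2 + (x$2)^2"
  by (simp add: norm_vec_def L2_set_def sum_2)

lemma norm_cmul: "norm (cmul z x) = cmod z * norm x"
proof -
  have "norm (cmul z x) ^ 2 = (cmod z * norm x) ^ 2"
    by (simp add: norm_real2 power_mult_distrib cmod_power2) (simp add: power2_eq_square algebra_simps)
  then show ?thesis by simp
qed

lemma linear_cmul: "linear (cmul z)"
  by (intro linearI) (auto simp: vec_eq_iff forall_2 algebra_simps)

lemma continuous_on_cmul [continuous_intros]:
  assumes "continuous_on S f" "continuous_on S g"
  shows "continuous_on S (\<lambda>t. cmul (f t) (g t))"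
proof -
  have "continuous_on S (\<lambda>t. cmul (f t) (g t) $ i)" for i
    using exhaust_2[of i] by (elim disjE) (simp_all only: cmul_nth, (intro continuous_intros assms)+)
  from continuous_on_vec_lambda[of S "\<lambda>i t. cmul (f t) (g t) $ i", OF this] show ?thesis by simp
qed

lemma det_cmul: "det (matrix (cmul z)) = cmod z ^ 2"
  by (simp add: det_2 matrix_def axis_def cmod_power2) (simp add: power2_eq_square)

lemma cmul_mult: "cmul (z * w) x = cmul z (cmul w x)"
  by (simp add: vec_eq_iff forall_2 algebra_simps)

lemma cmul_one [simp]: "cmul 1 x = x"
  by (simp add: vec_eq_iff forall_2)

lemma surj_cmul: "z \<noteq> 0 \<Longrightarrow> range (cmul z) = UNIV"
  by (metis cmul_mult cmul_one right_inverse surjI)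

text \<open>Linear change of variables: \<open>cmul z\<close> is onto for nonzero \<open>z\<close>
  and its determinant is the squared modulus of \<open>z\<close>.\<close>

lemma integral_cmul:
  fixes G :: "real^2 \<Rightarrow> real"
  assumes G: "continuous_on UNIV G" "\<And>x. G x \<noteq> 0 \<Longrightarrow> norm x \<le> R" and "z \<noteq> 0"
  shows "(\<integral>x. cmod z ^ 2 * G (cmul z x) \<partial>lborel) = (\<integral>x. G x \<partial>lborel)"
proof -
  have int: "integrable lborel G"
    by (rule integrable_compact_support[OF G])
  have "integrable lborel (\<lambda>x. G (cmul z x))"
  proof (rule integrable_compact_support)
    show "continuous_on UNIV (\<lambda>x. G (cmul z x))"
      by (intro continuous_on_compose2[OF G(1)] continuous_intros) auto
    show "norm x \<le> R / cmod z" if "G (cmul z x) \<noteq> 0" for x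
      using G(2)[OF that] \<open>z \<noteq> 0\<close> by (simp add: norm_cmul field_simps)
  qed
  then have int': "integrable lborel (\<lambda>x. cmod z ^ 2 * G (cmul z x))" by simp
  \<comment> \<open>The substitution theorem speaks of vector-valued functions, so \<open>G\<close>
    is read as a function into \<open>real^1\<close>.\<close>
  have "((\<lambda>x. vec (G x)) :: _ \<Rightarrow> real^1) absolutely_integrable_on range (cmul z)"
    using int unfolding surj_cmul[OF \<open>z \<noteq> 0\<close>]
    by (subst absolutely_integrable_on_1_iff)
      (simp add: set_integrable_def integrable_completion borel_measurable_integrable)
  then have "integral (range (cmul z)) ((\<lambda>x. vec (G x)) :: _ \<Rightarrow> real^1) =
      \<bar>det (matrix (cmul z))\<bar> *\<^sub>R integral UNIV (((\<lambda>x. vec (G x)) :: _ \<Rightarrow> real^1) \<circ> cmul z)"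
    by (intro integral_change_of_variables_linear linear_cmul) simp
  then have "integral UNIV G = integral UNIV (\<lambda>x. cmod z ^ 2 * G (cmul z x))"
    by (simp add: surj_cmul[OF \<open>z \<noteq> 0\<close>] det_cmul integral_on_1_eq vec_eq_iff o_def)
  then show ?thesis
    using integral_lborel[OF int] integral_lborel[OF int'] by metis
qed

text \<open>Fubini: for each \<open>t\<close> the integral over \<open>x\<close> is that of
  \<open>G\<close>. A planar integral thus vanishes, or is nonnegative, as soon as the integrals
  along the orbits are. The bound \<open>cmod (z t) \<ge> 1\<close> keeps \<open>z t\<close> nonzero
  and all transformed supports inside the ball of radius \<open>R\<close>.\<close>

lemma integral_cmul_average:
  fixes G :: "real^2 \<Rightarrow> real" and z :: "real \<Rightarrow> complex"
  assumes G: "continuous_on UNIV G" "\<And>x. G x \<noteq> 0 \<Longrightarrow> norm x \<le> R"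
    and z: "continuous_on {0..T} z" "\<And>t. t \<in> {0..T} \<Longrightarrow> cmod (z t) \<ge> 1" and "T \<ge> 0"
  shows "(\<integral>x. integral {0..T} (\<lambda>t. cmod (z t) ^ 2 * G (cmul (z t) x)) \<partial>lborel) = T * (\<integral>x. G x \<partial>lborel)"
proof -
  let ?g = "\<lambda>t x. cmod (z t) ^ 2 * G (cmul (z t) x)"
  let ?f = "\<lambda>t x. indicator {0..T} t *\<^sub>R ?g t x"
  have supp: "norm x \<le> R" if "G (cmul (z t) x) \<noteq> 0" "t \<in> {0..T}" for x t
    using G(2)[OF that(1)] mult_right_mono[OF z(2)[OF that(2)], of "norm x"] 
    by (simp add: norm_cmul)
  have "integrable lborel (\<lambda>p :: real \<times> (real^2). indicator ({0..T} \<times> cball 0 R) p *\<^sub>R ?g (fst p) (snd p))"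
    by (intro borel_integrable_compact compact_Times continuous_intros
        continuous_on_compose2[OF G(1)] continuous_on_compose2[OF z(1)]) auto
  also have "(\<lambda>p. indicator ({0..T} \<times> cball 0 R) p *\<^sub>R ?g (fst p) (snd p)) = case_prod ?f"
    using supp by (force simp: fun_eq_iff indicator_def)
  finally have "integrable (lborel \<Otimes>\<^sub>M lborel) (case_prod ?f)"
    by (simp add: lborel_prod)
  from lborel_pair.Fubini_integral[OF this]
  have 1: "(\<integral>x. (\<integral>t. ?f t x \<partial>lborel) \<partial>lborel) = (\<integral>t. (\<integral>x. ?f t x \<partial>lborel) \<partial>lborel)" .
  have 2: "(\<integral>t. ?f t x \<partial>lborel) = integral {0..T} (\<lambda>t. ?g t x)" for x
  proof -
    have "continuous_on {0..T} (\<lambda>t. ?g t x)"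
      by (intro continuous_intros continuous_on_compose2[OF G(1)] z) auto
    from set_borel_integral_eq_integral(2)[OF borel_integrable_atLeastAtMost'[OF this]]
    show ?thesis by (simp add: set_lebesgue_integral_def)
  qed
  have 3: "(\<integral>x. ?f t x \<partial>lborel) = indicator {0..T} t *\<^sub>R (\<integral>x. G x \<partial>lborel)" for t
  proof (cases "t \<in> {0..T}")
    case True
    then have "z t \<noteq> 0" using z(2)[OF True] by auto
    then show ?thesis using True integral_cmul[OF G] by simp
  qed simp
  have 4: "(\<integral>t. indicator {0..T} t *\<^sub>R (\<integral>x. G x \<partial>lborel) \<partial>lborel) = T * (\<integral>x. G x \<partial>lborel)"
    using \<open>T \<ge> 0\<close> by simp
  show ?thesis using 1 unfolding 2 3 4 .
qed

section \<open>The Euler and rotation fields as generators of dilations and rotations\<close>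

definition euler :: "(real^2 \<Rightarrow> complex) \<Rightarrow> real^2 \<Rightarrow> complex" where
  "euler f x = of_real (x$1) * pderivative 1 f x + of_real (x$2) * pderivative 2 f x"

text \<open>The difference is written as a sum with a \<open>- 1\<close> multiple, so that closure
  under sums and scalar multiples applies directly.\<close>

definition rotation :: "(real^2 \<Rightarrow> complex) \<Rightarrow> real^2 \<Rightarrow> complex" where
  "rotation f x = of_real (x$1) * pderivative 2 f x + (- 1) * (of_real (x$2) * pderivative 1 f x)"

lemma smooth_euler: "smooth f \<Longrightarrow> smooth (euler f)"
  unfolding euler_def[abs_def] by (intro smooth_add smooth_coordinate_mult smooth_pderivative)

lemma smooth_rotation: "smooth f \<Longrightarrow> smooth (rotation f)"
  unfolding rotation_def[abs_def]
  by (intro smooth_add smooth_cmult smooth_coordinate_mult smooth_pderivative)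

lemma annular_euler: "annular f \<Longrightarrow> annular (euler f)"
  unfolding euler_def[abs_def]
  by (intro annular_add; rule annular_mono[OF annular_pderivative]) auto

lemma annular_rotation: "annular f \<Longrightarrow> annular (rotation f)"
  unfolding rotation_def[abs_def]
  by (intro annular_add; rule annular_mono[OF annular_pderivative]) auto

text \<open>Chain rule along the curve \<open>cmul (z t) x\<close>. With \<open>exp\<close> the
  velocity is the position vector, which yields \<open>euler\<close>; with \<open>cis\<close> it is
  the position vector turned by a right angle, which yields \<open>rotation\<close>.\<close>

lemma has_vector_derivative_cmul:
  assumes f: "smooth f" and z: "(z has_vector_derivative w) (at t)"
  shows "((\<lambda>t. f (cmul (z t) x)) has_vector_derivative
    (\<Sum>i\<in>UNIV. cmul w x $ i *\<^sub>R pderivative i f (cmul (z t) x))) (at t)"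
proof -
  have "((\<lambda>t. Re (z t)) has_real_derivative Re w) (at t)"
    "((\<lambda>t. Im (z t)) has_real_derivative Im w) (at t)"
    using z unfolding has_real_derivative_iff_has_vector_derivative
    by (auto intro: bounded_linear.has_vector_derivative bounded_linear_Re bounded_linear_Im)
  note D = DERIV_cmult_right[OF this(1)] DERIV_cmult_right[OF this(2)]
  have "((\<lambda>t. cmul (z t) x $ i) has_real_derivative cmul w x $ i) (at t)" for i
    using exhaust_2[of i] by (elim disjE) (simp_all only: cmul_nth, (intro DERIV_diff DERIV_add D)+)
  then have "((\<lambda>t. cmul (z t) x $ i) has_derivative (\<lambda>s. (s *\<^sub>R cmul w x) $ i)) (at t)" for i
    by (simp add: has_field_derivative_def mult.commute[of "cmul w x $ i"] mult_commute_abs)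
  then have "((\<lambda>t. cmul (z t) x) has_derivative (\<lambda>s. s *\<^sub>R cmul w x)) (at t)"
    unfolding has_derivative_componentwise_within[of "\<lambda>t. cmul (z t) x"] 
    by (auto simp: Basis_vec_def inner_axis)
  from has_derivative_compose[OF this has_derivative_pderivative[OF smooth_imp_differentiable[OF f]]]
  show ?thesis
    by (simp add: has_vector_derivative_def scaleR_sum_right)
qed

lemma has_vector_derivative_dilation:
  assumes "smooth f"
  shows "((\<lambda>t. f (cmul (exp (of_real t)) x)) has_vector_derivative
    euler f (cmul (exp (of_real t)) x)) (at t)"
proof -
  have "((\<lambda>t. exp (complex_of_real t)) has_vector_derivative exp (of_real t)) (at t)"
    by (auto intro!: derivative_eq_intros has_vector_derivative_real_field)
  from has_vector_derivative_cmul[OF assms this] show ?thesis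
    by (simp add: sum_2 euler_def scaleR_conv_of_real)
qed

lemma has_vector_derivative_rotation:
  assumes "smooth f"
  shows "((\<lambda>t. f (cmul (cis t) x)) has_vector_derivative rotation f (cmul (cis t) x)) (at t)"
proof -
  have "(cis has_vector_derivative \<i> * cis t) (at t)"
    using has_derivative_cis[OF has_derivative_ident, of t UNIV] by (simp add: has_vector_derivative_def)
  from has_vector_derivative_cmul[OF assms this] show ?thesis
    by (simp add: sum_2 rotation_def scaleR_conv_of_real algebra_simps)
qed

section \<open>Fourier series on the circle\<close>

text \<open>Not normalised: the coefficient of \<open>cis (k * t)\<close> in the Fourier series is
  this value divided by \<open>2 * pi\<close>, which explains the factors \<open>2 * pi\<close>
  below.\<close>

definition fourier_coeff :: "(real \<Rightarrow> complex) \<Rightarrow> int \<Rightarrow> complex" where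
  "fourier_coeff f k = integral {0..2*pi} (\<lambda>t. f t * cis (- (of_int k * t)))"

lemma has_vector_derivative_cis_int:
  "((\<lambda>t. cis (of_int k * t)) has_vector_derivative \<i> * of_int k * cis (of_int k * t)) (at t within S)"
  unfolding has_vector_derivative_def
  by (auto intro!: derivative_eq_intros simp: scaleR_conv_of_real)

lemma cis_int_two_pi: "cis (of_int k * (2 * pi)) = 1"
  by (metis cis_multiple_2pi Ints_of_int mult.commute)

lemma has_integral_cis_int:
  "((\<lambda>t. cis (of_int k * t)) has_integral (if k = 0 then 2 * of_real pi else 0)) {0..2*pi}"
proof (cases "k = 0")
  case True
  then show ?thesis
    using has_integral_const_real[of "1::complex" 0 "2 * pi"] by (simp add: scaleR_conv_of_real)
next
  case False
  have "((\<lambda>t. cis (of_int k * t) / (\<i> * of_int k)) has_vector_derivative cis (of_int k * t))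
      (at t within {0..2*pi})" for t
    using has_vector_derivative_divide[OF has_vector_derivative_cis_int[of k t "{0..2*pi}"], of "\<i> * of_int k"] False
    by simp
  from fundamental_theorem_of_calculus[OF _ this] show ?thesis
    using False by (simp add: cis_int_two_pi)
qed

lemma has_integral_fourier_coeff:
  assumes "continuous_on {0..2*pi} f"
  shows "((\<lambda>t. f t * cis (- (of_int k * t))) has_integral fourier_coeff f k) {0..2*pi}"
  unfolding fourier_coeff_def
  by (intro integrable_integral integrable_continuous_real continuous_intros assms)

text \<open>
  Dropping the last sum gives the best approximation property of the Fourier coefficients; choosing
  \<open>d\<close> so that it vanishes gives Bessel's inequality.
\<close>

lemma integral_norm_diff_trig_sum:
  fixes d :: "int \<Rightarrow> complex"
  assumes f: "continuous_on {0..2*pi} f" and K: "finite K"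
  shows "integral {0..2*pi} (\<lambda>t. norm (f t - (\<Sum>k\<in>K. d k * cis (of_int k * t))) ^ 2) =
    integral {0..2*pi} (\<lambda>t. norm (f t) ^ 2) - (\<Sum>k\<in>K. norm (fourier_coeff f k) ^ 2) / (2 * pi)
    + 2 * pi * (\<Sum>k\<in>K. norm (d k - fourier_coeff f k / (2 * of_real pi)) ^ 2)"
proof -
  define I where "I = integral {0..2*pi} (\<lambda>t. norm (f t) ^ 2)"
  define c where "c = fourier_coeff f"
  have I: "((\<lambda>t. of_real (norm (f t) ^ 2)) has_integral complex_of_real I) {0..2*pi}"
    unfolding I_def
    by (intro has_integral_of_real integrable_integral integrable_continuous_real continuous_intros f)
  have 1: "((\<lambda>t. \<Sum>k\<in>K. cnj (d k) * (f t * cis (- (of_int k * t)))) has_integral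
      (\<Sum>k\<in>K. cnj (d k) * c k)) {0..2*pi}"
    unfolding c_def
    by (intro has_integral_sum[OF K] has_integral_mult_right has_integral_fourier_coeff f)
  have 2: "((\<lambda>t. cnj (\<Sum>k\<in>K. cnj (d k) * (f t * cis (- (of_int k * t))))) has_integral
      cnj (\<Sum>k\<in>K. cnj (d k) * c k)) {0..2*pi}"
    using has_integral_linear[OF 1 bounded_linear_cnj] by (simp only: o_def)
  have 3: "((\<lambda>t. \<Sum>j\<in>K. \<Sum>k\<in>K. d j * cnj (d k) * cis (of_int (j - k) * t)) has_integral
      (\<Sum>j\<in>K. \<Sum>k\<in>K. d j * cnj (d k) * (if j - k = 0 then 2 * of_real pi else 0))) {0..2*pi}"
    by (intro has_integral_sum[OF K] has_integral_mult_right has_integral_cis_int)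
  \<comment> \<open>Expand the squared norm of \<open>f t - p\<close> in the complex numbers as a
    product with its conjugate; the real part is taken only at the end.\<close>
  have "of_real (norm (f t - (\<Sum>k\<in>K. d k * cis (of_int k * t))) ^ 2) =
      of_real (norm (f t) ^ 2) - (\<Sum>k\<in>K. cnj (d k) * (f t * cis (- (of_int k * t))))
      - cnj (\<Sum>k\<in>K. cnj (d k) * (f t * cis (- (of_int k * t))))
      + (\<Sum>j\<in>K. \<Sum>k\<in>K. d j * cnj (d k) * cis (of_int (j - k) * t))" for t
  proof -
    define p where "p = (\<Sum>k\<in>K. d k * cis (of_int k * t))"
    have p1: "(\<Sum>k\<in>K. cnj (d k) * (f t * cis (- (of_int k * t)))) = f t * cnj p"
      by (simp add: p_def sum_distrib_left cis_cnj mult_ac)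
    have p2: "(\<Sum>j\<in>K. \<Sum>k\<in>K. d j * cnj (d k) * cis (of_int (j - k) * t)) = p * cnj p"
      by (simp add: p_def sum_product cis_cnj cis_divide[symmetric] left_diff_distrib
          flip: cis_divide cis_inverse) (simp add: divide_inverse mult_ac)
    show ?thesis
      unfolding p1 p2 p_def[symmetric] complex_norm_square by (simp add: algebra_simps)
  qed
  then have "((\<lambda>t. complex_of_real (norm (f t - (\<Sum>k\<in>K. d k * cis (of_int k * t))) ^ 2)) has_integral
      (of_real I - (\<Sum>k\<in>K. cnj (d k) * c k) - cnj (\<Sum>k\<in>K. cnj (d k) * c k) +
      (\<Sum>j\<in>K. \<Sum>k\<in>K. d j * cnj (d k) * (if j - k = 0 then 2 * of_real pi else 0)))) {0..2*pi}"
    using has_integral_add[OF has_integral_diff[OF has_integral_diff[OF I 1] 2] 3] by presburger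
  \<comment> \<open>Orthogonality of the characters leaves only the diagonal.\<close>
  also have "(\<Sum>j\<in>K. \<Sum>k\<in>K. d j * cnj (d k) * (if j - k = 0 then 2 * of_real pi else 0)) =
      (\<Sum>k\<in>K. 2 * of_real pi * (d k * cnj (d k)))"
    using K by (simp add: if_distrib[of "\<lambda>x. _ * x"] sum.delta mult_ac cong: if_cong)
  also have "of_real I - (\<Sum>k\<in>K. cnj (d k) * c k) - cnj (\<Sum>k\<in>K. cnj (d k) * c k) + \<dots> =
      of_real I + (\<Sum>k\<in>K. 2 * of_real pi * (d k * cnj (d k)) - cnj (d k) * c k - d k * cnj (c k))"
    by (simp add: sum_subtractf)
  \<comment> \<open>Complete the square in each \<open>d k\<close>.\<close>
  also have "\<dots> = of_real I + (\<Sum>k\<in>K. 2 * of_real pi *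
      ((d k - c k / (2 * of_real pi)) * cnj (d k - c k / (2 * of_real pi))) - (c k * cnj (c k)) / (2 * of_real pi))"
  proof -
    have "2 * of_real pi * (z * cnj z) - cnj z * w - z * cnj w =
        2 * of_real pi * ((z - w / (2 * of_real pi)) * cnj (z - w / (2 * of_real pi))) -
        w * cnj w / (2 * of_real pi)" for z w
    proof -
      define P where "P = 2 * complex_of_real pi"
      have "P \<noteq> 0" "cnj P = P" by (simp_all add: P_def)
      then show ?thesis
        unfolding P_def[symmetric] complex_cnj_diff complex_cnj_divide
        by (simp add: divide_simps) (simp add: algebra_simps)
    qed
    then show ?thesis by simp
  qed
  also have "\<dots> = of_real (I - (\<Sum>k\<in>K. norm (c k) ^ 2) / (2 * pi) +
      2 * pi * (\<Sum>k\<in>K. norm (d k - c k / (2 * of_real pi)) ^ 2))"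
    by (simp only: complex_norm_square[symmetric])
      (simp add: sum_subtractf sum_distrib_left sum_divide_distrib)
  finally have "((\<lambda>t. Re (complex_of_real (norm (f t - (\<Sum>k\<in>K. d k * cis (of_int k * t))) ^ 2))) has_integral
      Re (of_real (I - (\<Sum>k\<in>K. norm (c k) ^ 2) / (2 * pi) +
      2 * pi * (\<Sum>k\<in>K. norm (d k - c k / (2 * of_real pi)) ^ 2)))) {0..2*pi}"
    by (rule has_integral_Re)
  then show ?thesis
    unfolding Re_complex_of_real I_def c_def by (rule integral_unique)
qed

lemma bessel_inequality:
  assumes f: "continuous_on {0..2*pi} f" and K: "finite K"
  shows "(\<Sum>k\<in>K. norm (fourier_coeff f k) ^ 2) / (2 * pi) \<le> integral {0..2*pi} (\<lambda>t. norm (f t) ^ 2)"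
proof -
  let ?d = "\<lambda>k. fourier_coeff f k / (2 * of_real pi)"
  have "0 \<le> integral {0..2*pi} (\<lambda>t. norm (f t - (\<Sum>k\<in>K. ?d k * cis (of_int k * t))) ^ 2)"
    by (intro integral_nonneg integrable_continuous_real continuous_intros f) auto
  then show ?thesis
    unfolding integral_norm_diff_trig_sum[OF f K] by simp
qed

section \<open>Trigonometric polynomials, their density, and approximate Parseval\<close>

text \<open>The inductive form makes closure under products a double induction;
  \<open>trig_poly_sum\<close> recovers a finite sum over distinct frequencies.\<close>

inductive trig_poly :: "(real \<Rightarrow> complex) \<Rightarrow> bool" where
  monom: "trig_poly (\<lambda>t. d * cis (of_int k * t))"
| add: "trig_poly p \<Longrightarrow> trig_poly q \<Longrightarrow> trig_poly (\<lambda>t. p t + q t)"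

lemma trig_poly_mult:
  assumes "trig_poly p" "trig_poly q"
  shows "trig_poly (\<lambda>t. p t * q t)"
  using assms(1)
proof induction
  case (monom d k)
  show ?case using assms(2)
  proof induction
    case (monom e l)
    have "(\<lambda>t. d * cis (of_int k * t) * (e * cis (of_int l * t))) =
        (\<lambda>t. d * e * cis (of_int (k + l) * t))"
      by (simp add: fun_eq_iff distrib_right flip: cis_mult)
    then show ?case using trig_poly.monom by metis
  next
    case (add p q)
    then show ?case
      using trig_poly.add by (simp add: distrib_left)
  qed
next
  case (add p q)
  then show ?case
    using trig_poly.add by (simp add: distrib_right)
qed

lemma trig_poly_const: "trig_poly (\<lambda>t. c)"
  using monom[of c 0] by simp

text \<open>A linear form restricts to the circle as a combination of \<open>cos t\<close> and
  \<open>sin t\<close>, hence of \<open>cis t\<close> and \<open>cis (- t)\<close> by Euler's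
  formulas. Constants, sums and products follow by closure.\<close>

lemma trig_poly_polynomial:
  assumes "real_polynomial_function g"
  shows "trig_poly (\<lambda>t. of_real (g (cis t)))"
  using assms
proof induction
  case (linear g)
  interpret bounded_linear g by fact
  have "g (cis t) = cos t * g 1 + sin t * g \<i>" for t
  proof -
    have "cis t = cos t *\<^sub>R 1 + sin t *\<^sub>R \<i>"
      by (simp add: complex_eq_iff)
    then show ?thesis by (simp only: add scaleR) simp
  qed
  then have "(\<lambda>t. complex_of_real (g (cis t))) = (\<lambda>t.
      ((g 1 - \<i> * g \<i>) / 2) * cis (of_int 1 * t) + ((g 1 + \<i> * g \<i>) / 2) * cis (of_int (- 1) * t))"
    by (auto simp: fun_eq_iff complex_eq_iff field_simps)
  then show ?case
    by (simp only: trig_poly.add[OF trig_poly.monom trig_poly.monom])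
next
  case (const c)
  show ?case by (rule trig_poly_const)
next
  case (add f g)
  then show ?case using trig_poly.add by simp
next
  case (mult f g)
  then show ?case using trig_poly_mult by simp
qed

lemma trig_poly_sum:
  assumes "trig_poly p"
  shows "\<exists>K d. finite K \<and> p = (\<lambda>t. \<Sum>k\<in>K. d k * cis (of_int k * t))"
  using assms
proof induction
  case (monom d k)
  show ?case by (intro exI[of _ "{k}"] exI[of _ "\<lambda>_. d"]) simp
next
  case (add p q)
  then obtain K d L e where K: "finite K" "p = (\<lambda>t. \<Sum>k\<in>K. d k * cis (of_int k * t))"
    and L: "finite L" "q = (\<lambda>t. \<Sum>k\<in>L. e k * cis (of_int k * t))"
    by blast
  \<comment> \<open>Extend both coefficient families by zero to the common index set.\<close>
  have "p t = (\<Sum>k\<in>K \<union> L. (if k \<in> K then d k else 0) * cis (of_int k * t))"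
    "q t = (\<Sum>k\<in>K \<union> L. (if k \<in> L then e k else 0) * cis (of_int k * t))" for t
    unfolding K L using K(1) L(1) by (auto intro!: sum.mono_neutral_cong_left)
  then have "(\<lambda>t. p t + q t) = (\<lambda>t. \<Sum>k\<in>K \<union> L.
      ((if k \<in> K then d k else 0) + (if k \<in> L then e k else 0)) * cis (of_int k * t))"
    by (simp add: distrib_right sum.distrib)
  then show ?case using K(1) L(1) by (intro exI[of _ "K \<union> L"] exI) (auto simp only: finite_Un)
qed

text \<open>Real Stone-Weierstrass on the unit circle, applied to real and imaginary parts with
  error \<open>e / 2\<close> each. Taking \<open>H\<close> on the circle instead of on an interval
  builds in periodicity.\<close>

lemma trig_poly_dense:
  assumes H: "continuous_on (sphere 0 1) H" and "e > 0"
  obtains p where "trig_poly p" "\<And>t. norm (H (cis t) - p t) < e"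
proof -
  obtain g1 where g1: "real_polynomial_function g1"
    "\<And>x. x \<in> sphere 0 1 \<Longrightarrow> \<bar>Re (H x) - g1 x\<bar> < e / 2"
    using Stone_Weierstrass_real_polynomial_function[of "sphere 0 1" "\<lambda>x. Re (H x)" "e / 2"]
      assms by (auto intro: continuous_intros)
  obtain g2 where g2: "real_polynomial_function g2"
    "\<And>x. x \<in> sphere 0 1 \<Longrightarrow> \<bar>Im (H x) - g2 x\<bar> < e / 2"
    using Stone_Weierstrass_real_polynomial_function[of "sphere 0 1" "\<lambda>x. Im (H x)" "e / 2"]
      assms by (auto intro: continuous_intros)
  show ?thesis
  proof
    show "trig_poly (\<lambda>t. of_real (g1 (cis t)) + \<i> * of_real (g2 (cis t)))"
      by (intro trig_poly.add trig_poly_mult trig_poly_const trig_poly_polynomial g1 g2)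
    fix t
    have "norm (H (cis t) - (of_real (g1 (cis t)) + \<i> * of_real (g2 (cis t)))) \<le>
        \<bar>Re (H (cis t)) - g1 (cis t)\<bar> + \<bar>Im (H (cis t)) - g2 (cis t)\<bar>"
      using cmod_le[of "H (cis t) - (of_real (g1 (cis t)) + \<i> * of_real (g2 (cis t)))"] by simp
    then show "norm (H (cis t) - (of_real (g1 (cis t)) + \<i> * of_real (g2 (cis t)))) < e"
      using g1(2)[of "cis t"] g2(2)[of "cis t"] by simp
  qed
qed

text \<open>Take the frequencies of a uniformly close trigonometric polynomial. Its mean square
  distance from the function is at most \<open>e\<close>, and the Fourier coefficients on these
  frequencies do at least as well.\<close>

lemma parseval_approx:
  assumes H: "continuous_on (sphere 0 1) H" and "e > 0"
  obtains K where "finite K" "integral {0..2*pi} (\<lambda>t. norm (H (cis t)) ^ 2) \<le>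
    (\<Sum>k\<in>K. norm (fourier_coeff (\<lambda>t. H (cis t)) k) ^ 2) / (2 * pi) + e"
proof -
  \<comment> \<open>Chosen so that \<open>2 * pi * \<epsilon> ^ 2 = e\<close>.\<close>
  define \<epsilon> where "\<epsilon> = sqrt (e / (2 * pi))"
  have "\<epsilon> > 0" using \<open>e > 0\<close> by (simp add: \<epsilon>_def)
  from trig_poly_dense[OF H this] obtain p where p: "trig_poly p" "\<And>t. norm (H (cis t) - p t) < \<epsilon>" by blast
  obtain K d where K: "finite K" and pK: "p = (\<lambda>t. \<Sum>k\<in>K. d k * cis (of_int k * t))"
    using trig_poly_sum[OF p(1)] by blast
  have cont: "continuous_on {0..2*pi} (\<lambda>t. H (cis t))"
    by (intro continuous_on_compose2[OF H] continuous_intros) auto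
  have "integral {0..2*pi} (\<lambda>t. norm (H (cis t) - p t) ^ 2) \<le> integral {0..2*pi} (\<lambda>t. \<epsilon> ^ 2)"
    unfolding pK using p(2)[unfolded pK]
    by (intro integral_le integrable_continuous_real continuous_intros cont power_mono) (auto intro: less_imp_le)
  also have "\<dots> = e" using \<open>e > 0\<close> by (simp add: \<epsilon>_def)
  finally have "integral {0..2*pi} (\<lambda>t. norm (H (cis t)) ^ 2) - (\<Sum>k\<in>K. norm (fourier_coeff (\<lambda>t. H (cis t)) k) ^ 2) / (2 * pi)
    + 2 * pi * (\<Sum>k\<in>K. norm (d k - fourier_coeff (\<lambda>t. H (cis t)) k / (2 * of_real pi)) ^ 2) \<le> e"
    unfolding pK integral_norm_diff_trig_sum[OF cont K] .
  moreover have "2 * pi * (\<Sum>k\<in>K. norm (d k - fourier_coeff (\<lambda>t. H (cis t)) k / (2 * of_real pi)) ^ 2) \<ge> 0"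
    by (simp add: sum_nonneg)
  ultimately show ?thesis using that[OF K] by simp
qed

section \<open>The inequality on the circle, mode by mode\<close>

text \<open>Integration by parts; the boundary terms cancel by periodicity.\<close>

lemma fourier_coeff_deriv:
  assumes h: "\<And>t. (h has_vector_derivative h' t) (at t)" and h': "continuous_on {0..2*pi} h'"
    and per: "h (2 * pi) = h 0"
  shows "fourier_coeff h' k = \<i> * of_int k * fourier_coeff h k"
proof -
  have "((\<lambda>t. h t * cis (of_int (- k) * t)) has_vector_derivative
      h t * (\<i> * of_int (- k) * cis (of_int (- k) * t)) + h' t * cis (of_int (- k) * t)) (at t within {0..2*pi})" for t
    by (intro has_vector_derivative_mult has_vector_derivative_cis_int has_vector_derivative_at_within[OF h])
  from fundamental_theorem_of_calculus[OF _ this]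
  have 1: "((\<lambda>t. h t * (\<i> * of_int (- k) * cis (of_int (- k) * t)) + h' t * cis (of_int (- k) * t))
      has_integral 0) {0..2*pi}"
    by (simp add: per cis_int_two_pi[of "- k", simplified])
  have ch: "continuous_on {0..2*pi} h"
    by (intro continuous_at_imp_continuous_on ballI has_vector_derivative_continuous[OF h])
  have 2: "((\<lambda>t. h' t * cis (- (of_int k * t)) + - \<i> * of_int k * (h t * cis (- (of_int k * t))))
      has_integral fourier_coeff h' k + - \<i> * of_int k * fourier_coeff h k) {0..2*pi}"
    by (intro has_integral_add has_integral_mult_right has_integral_fourier_coeff h' ch)
  have "h t * (\<i> * of_int (- k) * cis (of_int (- k) * t)) + h' t * cis (of_int (- k) * t) =
      h' t * cis (- (of_int k * t)) + - \<i> * of_int k * (h t * cis (- (of_int k * t)))" for t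
    by simp
  with 1 2 have "fourier_coeff h' k + - \<i> * of_int k * fourier_coeff h k = 0"
    by (simp only: has_integral_unique)
  then show ?thesis by simp
qed

lemma fourier_coeff_lincomb:
  assumes "continuous_on {0..2*pi} f" "continuous_on {0..2*pi} g"
  shows "fourier_coeff (\<lambda>t. c * f t + g t) k = c * fourier_coeff f k + fourier_coeff g k"
proof -
  have "((\<lambda>t. (c * f t + g t) * cis (- (of_int k * t))) has_integral
      c * fourier_coeff f k + fourier_coeff g k) {0..2*pi}"
    using has_integral_add[OF has_integral_mult_right[OF has_integral_fourier_coeff[OF assms(1)]]
        has_integral_fourier_coeff[OF assms(2)]]
    by (simp add: distrib_right mult.assoc)
  then show ?thesis
    unfolding fourier_coeff_def[of "\<lambda>t. c * f t + g t"] by (rule integral_unique)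
qed

text \<open>For a Fourier coefficient \<open>c\<close> of frequency \<open>k\<close> the two sides
  become \<open>C * (k ^ 2 + 1 + a)\<close> and \<open>(1 - a - k ^ 2) ^ 2\<close> times
  \<open>norm c ^ 2\<close>, so \<open>C\<close> settles each mode. Summation takes an upper bound
  for the left integrals, from approximate Parseval, and a lower bound for the right one, from
  Bessel.\<close>

lemma angular_inequality:
  fixes H H1 :: "complex \<Rightarrow> complex" and h2 :: "real \<Rightarrow> complex"
  assumes H: "continuous_on (sphere 0 1) H" "continuous_on (sphere 0 1) H1"
    and h2: "continuous_on {0..2*pi} h2"
    and deriv: "\<And>t. ((\<lambda>t. H (cis t)) has_vector_derivative H1 (cis t)) (at t)"
      "\<And>t. ((\<lambda>t. H1 (cis t)) has_vector_derivative h2 t) (at t)"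
    and "a \<ge> 0" "C \<ge> 0"
    and C: "\<And>k::nat. C * (real k ^ 2 + a + 1) \<le> (real k ^ 2 + a - 1) ^ 2"
  shows "C * (integral {0..2*pi} (\<lambda>t. norm (H1 (cis t)) ^ 2) +
      (1 + a) * integral {0..2*pi} (\<lambda>t. norm (H (cis t)) ^ 2))
    \<le> integral {0..2*pi} (\<lambda>t. norm (of_real (1 - a) * H (cis t) + h2 t) ^ 2)"
proof (rule field_le_epsilon)
  fix e :: real assume "e > 0"
  let ?h = "\<lambda>t. H (cis t)" and ?h1 = "\<lambda>t. H1 (cis t)"
  \<comment> \<open>The two Parseval errors contribute \<open>C * (2 + a) * \<epsilon>\<close> in
    total; the added 1 keeps the denominator positive when \<open>C = 0\<close>.\<close>
  define \<epsilon> where "\<epsilon> = e / (C * (2 + a) + 1)"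
  have pos: "C * (2 + a) + 1 > 0" using \<open>a \<ge> 0\<close> \<open>C \<ge> 0\<close> by (simp add: add_nonneg_pos)
  then have "\<epsilon> > 0" using \<open>e > 0\<close> by (simp add: \<epsilon>_def)
  have cont: "continuous_on {0..2*pi} ?h" "continuous_on {0..2*pi} ?h1"
    by (intro continuous_on_compose2[OF H(1)] continuous_on_compose2[OF H(2)] continuous_intros; auto)+
  let ?S = "\<lambda>f K. (\<Sum>k\<in>K. norm (fourier_coeff f k) ^ 2) / (2 * pi)"
  obtain K0 where K0: "finite K0" "integral {0..2*pi} (\<lambda>t. norm (?h t) ^ 2) \<le> ?S ?h K0 + \<epsilon>"
    using parseval_approx[OF H(1) \<open>\<epsilon> > 0\<close>] by blast
  obtain K1 where K1: "finite K1" "integral {0..2*pi} (\<lambda>t. norm (?h1 t) ^ 2) \<le> ?S ?h1 K1 + \<epsilon>"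
    using parseval_approx[OF H(2) \<open>\<epsilon> > 0\<close>] by blast
  \<comment> \<open>One index set serves both functions, since enlarging it only adds nonnegative
    terms.\<close>
  define K where "K = K0 \<union> K1"
  have K: "finite K" using K0 K1 by (simp add: K_def)
  have "?S ?h K0 \<le> ?S ?h K" "?S ?h1 K1 \<le> ?S ?h1 K"
    using K by (auto simp: K_def intro!: divide_right_mono sum_mono2)
  then have I: "integral {0..2*pi} (\<lambda>t. norm (?h t) ^ 2) \<le> ?S ?h K + \<epsilon>"
    "integral {0..2*pi} (\<lambda>t. norm (?h1 t) ^ 2) \<le> ?S ?h1 K + \<epsilon>"
    using K0(2) K1(2) by simp_all
  have c1: "fourier_coeff ?h1 k = \<i> * of_int k * fourier_coeff ?h k" for k
    by (rule fourier_coeff_deriv[OF deriv(1) cont(2)]) simp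
  have c2: "fourier_coeff h2 k = \<i> * of_int k * fourier_coeff ?h1 k" for k
    by (rule fourier_coeff_deriv[OF deriv(2) h2]) simp
  have mode: "C * (norm (fourier_coeff ?h1 k) ^ 2 + (1 + a) * norm (fourier_coeff ?h k) ^ 2) \<le>
      norm (fourier_coeff (\<lambda>t. of_real (1 - a) * ?h t + h2 t) k) ^ 2" for k
  proof -
    define c where "c = fourier_coeff ?h k"
    \<comment> \<open>Frequencies are integers while the bound on \<open>C\<close> is indexed by
      naturals; only the square of \<open>k\<close> enters.\<close>
    define m where "m = real (nat \<bar>k\<bar>)"
    have m: "m ^ 2 = of_int k ^ 2" by (simp add: m_def)
    have "fourier_coeff (\<lambda>t. of_real (1 - a) * ?h t + h2 t) k = of_real (1 - a - of_int k ^ 2) * c"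
      unfolding fourier_coeff_lincomb[OF cont(1) h2] c2 c1 c_def
      by (simp add: algebra_simps power2_eq_square)
    then have "norm (fourier_coeff (\<lambda>t. of_real (1 - a) * ?h t + h2 t) k) ^ 2 =
        (1 - a - of_int k ^ 2) ^ 2 * norm c ^ 2"
      by (simp only: norm_mult norm_of_real power_mult_distrib power2_abs)
    also have "(1 - a - of_int k ^ 2) ^ 2 = (m ^ 2 + a - 1) ^ 2"
      unfolding m by (simp add: power2_eq_square algebra_simps)
    also have "(m ^ 2 + a - 1) ^ 2 * norm c ^ 2 \<ge> C * (m ^ 2 + a + 1) * norm c ^ 2"
      using C[of "nat \<bar>k\<bar>"] by (intro mult_right_mono) (auto simp: m_def)
    moreover have "norm (fourier_coeff ?h1 k) ^ 2 = m ^ 2 * norm c ^ 2"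
      unfolding c1 c_def[symmetric] m by (simp add: norm_mult power_mult_distrib)
    ultimately show ?thesis
      unfolding c_def[symmetric] by (simp add: algebra_simps)
  qed
  have "C * (integral {0..2*pi} (\<lambda>t. norm (?h1 t) ^ 2) + (1 + a) * integral {0..2*pi} (\<lambda>t. norm (?h t) ^ 2))
      \<le> C * ((?S ?h1 K + \<epsilon>) + (1 + a) * (?S ?h K + \<epsilon>))"
    using I \<open>a \<ge> 0\<close> \<open>C \<ge> 0\<close> by (intro mult_left_mono add_mono) auto
  also have "\<dots> = (\<Sum>k\<in>K. C * (norm (fourier_coeff ?h1 k) ^ 2 + (1 + a) * norm (fourier_coeff ?h k) ^ 2)) / (2 * pi)
      + C * (2 + a) * \<epsilon>"
    by (simp add: sum_distrib_left sum.distrib add_divide_distrib distrib_left flip: sum_distrib_left)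
      (simp add: algebra_simps)
  also have "\<dots> \<le> ?S (\<lambda>t. of_real (1 - a) * ?h t + h2 t) K + C * (2 + a) * \<epsilon>"
    by (intro add_right_mono divide_right_mono sum_mono mode) auto
  also have "?S (\<lambda>t. of_real (1 - a) * ?h t + h2 t) K \<le>
      integral {0..2*pi} (\<lambda>t. norm (of_real (1 - a) * ?h t + h2 t) ^ 2)"
    by (intro bessel_inequality K continuous_intros cont h2)
  also have "C * (2 + a) * \<epsilon> \<le> e"
    using pos \<open>e > 0\<close> by (simp add: \<epsilon>_def field_simps)
  finally show "C * (integral {0..2*pi} (\<lambda>t. norm (?h1 t) ^ 2) + (1 + a) * integral {0..2*pi} (\<lambda>t. norm (?h t) ^ 2))
    \<le> integral {0..2*pi} (\<lambda>t. norm (of_real (1 - a) * ?h t + h2 t) ^ 2) + e" by simp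
qed

section \<open>The weighted inner product\<close>

abbreviation (input) punctured_tests :: "(real^2 \<Rightarrow> complex) set" where
  "punctured_tests \<equiv> test_functions (UNIV - {0})"

lemma punctured_tests_add:
  "f \<in> punctured_tests \<Longrightarrow> g \<in> punctured_tests \<Longrightarrow> (\<lambda>x. f x + g x) \<in> punctured_tests"
  by (simp add: test_functions_punctured smooth_add annular_add)

lemma punctured_tests_cmult:
  "f \<in> punctured_tests \<Longrightarrow> (\<lambda>x. c * f x) \<in> punctured_tests"
  unfolding test_functions_punctured by (auto intro: smooth_cmult annular_mono)

lemma punctured_tests_euler: "f \<in> punctured_tests \<Longrightarrow> euler f \<in> punctured_tests"
  by (simp add: test_functions_punctured smooth_euler annular_euler)

lemma punctured_tests_rotation: "f \<in> punctured_tests \<Longrightarrow> rotation f \<in> punctured_tests"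
  by (simp add: test_functions_punctured smooth_rotation annular_rotation)

lemma continuous_on_punctured_tests: "f \<in> punctured_tests \<Longrightarrow> continuous_on S f"
  by (simp add: test_functions_punctured smooth_imp_continuous_on)

text \<open>Real part of the complex inner product with weight \<open>1 / norm x ^ 4\<close>: a
  symmetric real bilinear form with the same squared norms.\<close>

definition pairing :: "(real^2 \<Rightarrow> complex) \<Rightarrow> (real^2 \<Rightarrow> complex) \<Rightarrow> real" where
  "pairing f g = (\<integral>x. Re (f x * cnj (g x)) / norm x ^ 4 \<partial>lborel)"

lemma annular_pairing:
  assumes "f \<in> punctured_tests"
  shows "annular (\<lambda>x. Re (f x * cnj (g x)))"
  using assms unfolding test_functions_punctured by (auto intro: annular_mono)

lemma continuous_on_pairing:
  "f \<in> punctured_tests \<Longrightarrow> g \<in> punctured_tests \<Longrightarrow> continuous_on S (\<lambda>x. Re (f x * cnj (g x)))"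
  by (intro continuous_intros continuous_on_punctured_tests)

lemma integrable_pairing:
  assumes "f \<in> punctured_tests" "g \<in> punctured_tests"
  shows "integrable lborel (\<lambda>x. Re (f x * cnj (g x)) / norm x ^ 4)"
  by (intro integrable_annular_div continuous_on_pairing annular_pairing assms)

lemma pairing_commute: "pairing f g = pairing g f"
  unfolding pairing_def by (intro Bochner_Integration.integral_cong) (auto simp: mult.commute)

lemma pairing_add:
  assumes "f \<in> punctured_tests" "g \<in> punctured_tests" "h \<in> punctured_tests"
  shows "pairing (\<lambda>x. f x + g x) h = pairing f h + pairing g h"
proof -
  have "pairing f h + pairing g h =
      (\<integral>x. Re (f x * cnj (h x)) / norm x ^ 4 + Re (g x * cnj (h x)) / norm x ^ 4 \<partial>lborel)"
    unfolding pairing_def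
    by (intro Bochner_Integration.integral_add[symmetric] integrable_pairing assms)
  also have "\<dots> = pairing (\<lambda>x. f x + g x) h"
    unfolding pairing_def by (intro Bochner_Integration.integral_cong)
      (auto simp: distrib_right add_divide_distrib[symmetric])
  finally show ?thesis by simp
qed

lemma pairing_scale: "pairing (\<lambda>x. of_real c * f x) g = c * pairing f g"
proof -
  have "pairing (\<lambda>x. of_real c * f x) g = (\<integral>x. c * (Re (f x * cnj (g x)) / norm x ^ 4) \<partial>lborel)"
    unfolding pairing_def by (intro Bochner_Integration.integral_cong) (auto simp: algebra_simps)
  then show ?thesis unfolding pairing_def by (simp only: integral_mult_right_zero)
qed

lemma pairing_self: "pairing f f = (\<integral>x. norm (f x) ^ 2 / norm x ^ 4 \<partial>lborel)"
  unfolding pairing_def by (simp add: complex_norm_square[symmetric])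

lemma pairing_self_nonneg: "pairing f f \<ge> 0"
  unfolding pairing_self by simp

section \<open>Commutation rules and polar forms of Laplacian and gradient\<close>

lemma euler_add:
  assumes "smooth f" "smooth g"
  shows "euler (\<lambda>x. f x + g x) x = euler f x + euler g x"
  unfolding euler_def using assms
  by (simp add: pderivative_add smooth_imp_differentiable algebra_simps)

lemma euler_cmult:
  assumes "smooth f"
  shows "euler (\<lambda>x. c * f x) x = c * euler f x"
  unfolding euler_def using assms
  by (simp add: pderivative_cmult smooth_imp_differentiable algebra_simps)

lemma rotation_add:
  assumes "smooth f" "smooth g"
  shows "rotation (\<lambda>x. f x + g x) x = rotation f x + rotation g x"
  unfolding rotation_def using assms
  by (simp add: pderivative_add smooth_imp_differentiable algebra_simps)

lemma rotation_cmult: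
  assumes "smooth f"
  shows "rotation (\<lambda>x. c * f x) x = c * rotation f x"
  unfolding rotation_def using assms
  by (simp add: pderivative_cmult smooth_imp_differentiable algebra_simps)

lemma pderivative_euler:
  assumes "smooth f"
  shows "pderivative i (euler f) x = pderivative i f x + euler (pderivative i f) x"
  using exhaust_2[of i] unfolding euler_def
  by (subst pderivative_add) (auto simp: assms smooth_pderivative smooth_imp_differentiable
    differentiable_coordinate_mult pderivative_coordinate_mult pderivative_commute[OF assms, of 2 1])

lemma pderivative_rotation:
  assumes "smooth f"
  shows "pderivative 1 (rotation f) x = pderivative 2 f x + rotation (pderivative 1 f) x"
    "pderivative 2 (rotation f) x = - pderivative 1 f x + rotation (pderivative 2 f) x"
proof -
  have "pderivative i (rotation f) x =
      of_real (if i = 1 then 1 else 0) * pderivative 2 f x + of_real (x$1) * pderivative i (pderivative 2 f) x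
      + (- 1) * (of_real (if i = 2 then 1 else 0) * pderivative 1 f x + of_real (x$2) * pderivative i (pderivative 1 f) x)" for i
    unfolding rotation_def
    by (subst pderivative_add, simp_all only: pderivative_cmult pderivative_coordinate_mult
      assms smooth_pderivative smooth_imp_differentiable differentiable_coordinate_mult smooth_cmult smooth_coordinate_mult)
  then show "pderivative 1 (rotation f) x = pderivative 2 f x + rotation (pderivative 1 f) x"
    "pderivative 2 (rotation f) x = - pderivative 1 f x + rotation (pderivative 2 f) x"
    by (simp_all add: rotation_def pderivative_commute[OF assms, of 2 1])
qed

lemma euler_rotation_commute:
  assumes "smooth f"
  shows "euler (rotation f) x = rotation (euler f) x"
  unfolding euler_def[of "rotation f"] rotation_def[of "euler f"]
    pderivative_euler[OF assms] pderivative_rotation[OF assms]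
  unfolding euler_def rotation_def
  by (simp add: algebra_simps pderivative_commute[OF assms, of 2 1])

text \<open>The commutation rules make the square of \<open>euler\<close> contribute the first-order
  term \<open>euler f\<close> and the square of \<open>rotation\<close> its negative. These cancel,
  as do the mixed second derivatives.\<close>

lemma polar_laplacian:
  assumes "smooth f"
  shows "of_real (norm x ^ 2) * laplacian f x = euler (euler f) x + rotation (rotation f) x"
proof -
  have "of_real (norm x ^ 2) = complex_of_real (x$1) ^ 2 + of_real (x$2) ^ 2"
    by (simp add: norm_real2)
  then show ?thesis
    unfolding euler_def[of "euler f"] rotation_def[of "rotation f"]
      pderivative_euler[OF assms] pderivative_rotation[OF assms] laplacian_def sum_2
    unfolding euler_def rotation_def
    by (simp add: algebra_simps power2_eq_square pderivative_commute[OF assms, of 2 1])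
qed

text \<open>At \<open>x\<close> the pair \<open>euler f\<close>, \<open>rotation f\<close> arises
  from the two partial derivatives by a rotation scaled by \<open>norm x\<close>.\<close>

lemma polar_gradient:
  "norm x ^ 2 * norm (gradient f x) ^ 2 = norm (euler f x) ^ 2 + norm (rotation f x) ^ 2"
proof -
  have "norm (gradient f x) ^ 2 = norm (pderivative 1 f x) ^ 2 + norm (pderivative 2 f x) ^ 2"
    by (simp add: norm_vec_def L2_set_def sum_2 gradient_def)
  then show ?thesis
    unfolding euler_def rotation_def norm_real2 cmod_power2 
    by (simp add: power2_eq_square algebra_simps)
qed

section \<open>Skew-symmetry with respect to the weighted pairing\<close>

lemma has_vector_derivative_pairing:
  fixes f g :: "real \<Rightarrow> complex"
  assumes "(f has_vector_derivative f') (at t)" "(g has_vector_derivative g') (at t)"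
  shows "((\<lambda>t. Re (f t * cnj (g t))) has_vector_derivative Re (f' * cnj (g t)) + Re (f t * cnj g')) (at t)"
proof -
  have "((\<lambda>t. f t * cnj (g t)) has_vector_derivative f t * cnj g' + f' * cnj (g t)) (at t)"
    by (intro has_vector_derivative_mult assms
      bounded_linear.has_vector_derivative[OF bounded_linear_cnj])
  from bounded_linear.has_vector_derivative[OF bounded_linear_Re this] show ?thesis
    by (simp add: add.commute)
qed

text \<open>The sum of both integrands is, up to the weight, the derivative of
  \<open>Re (f * cnj g)\<close> along rotations. The weight is constant on circles, so the integral
  over a full turn vanishes, and averaging carries this to the plane.\<close>

lemma pairing_rotation:
  assumes f: "f \<in> punctured_tests" and g: "g \<in> punctured_tests"
  shows "pairing (rotation f) g = - pairing f (rotation g)"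
proof -
  note sm = f[unfolded test_functions_punctured, THEN conjunct1]
    g[unfolded test_functions_punctured, THEN conjunct1]
  note [simp] = punctured_tests_rotation[OF f] punctured_tests_rotation[OF g] f g
  let ?q = "\<lambda>x. Re (rotation f x * cnj (g x)) + Re (f x * cnj (rotation g x))"
  have cont: "continuous_on UNIV ?q"
    by (intro continuous_on_add continuous_on_pairing) simp_all
  have ann: "annular ?q"
    by (intro annular_add annular_pairing) simp_all
  then obtain R where R: "\<And>x. ?q x \<noteq> 0 \<Longrightarrow> norm x \<le> R"
    unfolding annular_def by blast
  have "integral {0..2*pi} (\<lambda>t. cmod (cis t) ^ 2 * (?q (cmul (cis t) x) / norm (cmul (cis t) x) ^ 4)) = 0" for x
  proof -
    note D = has_vector_derivative_pairing[OF has_vector_derivative_rotation[OF sm(1)]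
        has_vector_derivative_rotation[OF sm(2)], THEN has_vector_derivative_at_within]
    have "((\<lambda>t. ?q (cmul (cis t) x)) has_integral 0) {0..2*pi}"
      using fundamental_theorem_of_calculus[OF _ D, of 0 "2*pi" x x] by simp
    from integral_unique[OF this] show ?thesis
      by (simp only: norm_cmul norm_cis mult_1 power_one integral_divide div_0)
  qed
  moreover have "(\<integral>x. integral {0..2*pi} (\<lambda>t. cmod (cis t) ^ 2 * (?q (cmul (cis t) x) / norm (cmul (cis t) x) ^ 4)) \<partial>lborel)
      = 2 * pi * (\<integral>x. ?q x / norm x ^ 4 \<partial>lborel)"
    by (intro integral_cmul_average[where R = R] continuous_on_annular_div cont ann R continuous_intros) auto
  ultimately have "(\<integral>x. ?q x / norm x ^ 4 \<partial>lborel) = 0" by simp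
  moreover have "(\<integral>x. ?q x / norm x ^ 4 \<partial>lborel) = pairing (rotation f) g + pairing f (rotation g)"
    unfolding pairing_def add_divide_distrib
    by (intro Bochner_Integration.integral_add integrable_pairing) simp_all
  ultimately show ?thesis by simp
qed

text \<open>Invariance under dilations by \<open>exp t\<close>: the area contributes
  \<open>exp (2 * t)\<close> and the weight \<open>exp (- 4 * t)\<close>, and the net exponent
  \<open>- 2\<close> is the source of the factor 2. Equivalently, \<open>euler\<close> minus the
  identity is skew-symmetric.\<close>

lemma pairing_euler:
  assumes f: "f \<in> punctured_tests" and g: "g \<in> punctured_tests"
  shows "pairing (euler f) g + pairing f (euler g) = 2 * pairing f g"
proof -
  note sm = f[unfolded test_functions_punctured, THEN conjunct1]
    g[unfolded test_functions_punctured, THEN conjunct1]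
  note [simp] = punctured_tests_euler[OF f] punctured_tests_euler[OF g] f g
  let ?p = "\<lambda>x. Re (f x * cnj (g x))"
  let ?q = "\<lambda>x. Re (euler f x * cnj (g x)) + Re (f x * cnj (euler g x)) - 2 * ?p x"
  let ?z = "\<lambda>t. exp (complex_of_real t)"
  have cont: "continuous_on UNIV ?q"
    by (intro continuous_on_diff continuous_on_add continuous_on_mult_left continuous_on_pairing) simp_all
  have "annular ?p" by (intro annular_pairing) simp
  have contr: "continuous_on UNIV (\<lambda>x. ?p x / norm x ^ 4)"
    by (intro continuous_on_annular_div continuous_on_pairing \<open>annular ?p\<close>) simp_all
  have a1: "annular (\<lambda>x. - 2 * ?p x)" by (rule annular_mono[OF \<open>annular ?p\<close>]) simp
  have a2: "annular (\<lambda>x. Re (euler f x * cnj (g x)) + Re (f x * cnj (euler g x)))"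
    by (intro annular_add annular_pairing) simp_all
  have ann: "annular ?q"
    by (rule annular_mono[OF annular_add[OF a2 a1]]) simp
  then obtain R where R: "\<And>x. ?q x \<noteq> 0 \<Longrightarrow> norm x \<le> R"
    unfolding annular_def by blast
  obtain R' where R': "\<And>x. ?p x \<noteq> 0 \<Longrightarrow> norm x \<le> R'"
    using \<open>annular ?p\<close> unfolding annular_def by blast
  txt \<open>In \<open>inner\<close>, the integrand is the derivative of \<open>exp (- 2 t) * ?p (exp t * x) / norm x ^ 4\<close>.\<close>
  have inner: "integral {0..1} (\<lambda>t. cmod (?z t) ^ 2 * (?q (cmul (?z t) x) / norm (cmul (?z t) x) ^ 4)) =
      cmod (?z 1) ^ 2 * (?p (cmul (?z 1) x) / norm (cmul (?z 1) x) ^ 4) - ?p x / norm x ^ 4" for x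
  proof -
    have *: "cmod (?z t) ^ 2 * (c / norm (cmul (?z t) x) ^ 4) = exp (- 2 * t) * c / norm x ^ 4" for t c
    proof -
      have "exp t ^ 2 * exp (- 2 * t) = 1"
        by (simp add: exp_double[symmetric] exp_minus field_simps)
      then show ?thesis
        by (simp add: norm_cmul power_mult_distrib divide_simps) (auto simp: eval_nat_numeral algebra_simps)
    qed
    have "((\<lambda>t. exp (- 2 * t) *\<^sub>R ?p (cmul (?z t) x)) has_vector_derivative
        exp (- 2 * t) *\<^sub>R (Re (euler f (cmul (?z t) x) * cnj (g (cmul (?z t) x))) + Re (f (cmul (?z t) x) * cnj (euler g (cmul (?z t) x))))
        + (- 2 * exp (- 2 * t)) *\<^sub>R ?p (cmul (?z t) x)) (at t)" for t :: real
      by (intro has_vector_derivative_scaleR has_vector_derivative_pairing has_vector_derivative_dilation sm)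
        (auto intro!: derivative_eq_intros)
    from fundamental_theorem_of_calculus[OF _ has_vector_derivative_at_within[OF this], of 0 1]
    have "((\<lambda>t. exp (- 2 * t) * ?q (cmul (?z t) x)) has_integral exp (- 2 * 1) * ?p (cmul (?z 1) x) - ?p x) {0..1}"
      by (simp add: algebra_simps)
    from has_integral_divide[OF this, of "norm x ^ 4"] show ?thesis
      unfolding * diff_divide_distrib[symmetric] by (rule integral_unique)
  qed
  have "1 * (\<integral>x. ?q x / norm x ^ 4 \<partial>lborel) =
      (\<integral>x. integral {0..1} (\<lambda>t. cmod (?z t) ^ 2 * (?q (cmul (?z t) x) / norm (cmul (?z t) x) ^ 4)) \<partial>lborel)"
    by (intro integral_cmul_average[where R = R, symmetric] continuous_on_annular_div cont ann R continuous_intros) auto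
  also have "\<dots> = (\<integral>x. cmod (?z 1) ^ 2 * (?p (cmul (?z 1) x) / norm (cmul (?z 1) x) ^ 4) \<partial>lborel) -
      (\<integral>x. ?p x / norm x ^ 4 \<partial>lborel)"
    unfolding inner
  proof (rule Bochner_Integration.integral_diff)
    show "integrable lborel (\<lambda>x. ?p x / norm x ^ 4)"
      by (intro integrable_pairing) simp_all
    have "integrable lborel (\<lambda>x. ?p (cmul (?z 1) x) / norm (cmul (?z 1) x) ^ 4)"
    proof (rule integrable_compact_support)
      show "continuous_on UNIV (\<lambda>x. ?p (cmul (?z 1) x) / norm (cmul (?z 1) x) ^ 4)"
        by (intro continuous_on_compose2[OF contr] continuous_intros) auto
      show "norm x \<le> R'" if "?p (cmul (?z 1) x) / norm (cmul (?z 1) x) ^ 4 \<noteq> 0" for x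
      proof -
        have "norm x \<le> exp 1 * norm x" by (simp add: mult_le_cancel_right1)
        also have "\<dots> \<le> R'" using R'[of "cmul (?z 1) x"] that by (simp add: norm_cmul)
        finally show ?thesis .
      qed
    qed
    then show "integrable lborel (\<lambda>x. cmod (?z 1) ^ 2 * (?p (cmul (?z 1) x) / norm (cmul (?z 1) x) ^ 4))"
      by (intro integrable_mult_right)
  qed
  \<comment> \<open>Both integrals are of the same function, one of them after the substitution by
    \<open>?z 1\<close>.\<close>
  also have "\<dots> = 0"
    using integral_cmul[OF contr, of R' "?z 1"] R' by auto
  finally have "(\<integral>x. ?q x / norm x ^ 4 \<partial>lborel) = 0" by simp
  moreover have "(\<integral>x. ?q x / norm x ^ 4 \<partial>lborel) = pairing (euler f) g + pairing f (euler g) - 2 * pairing f g"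
  proof -
    have "(\<integral>x. ?q x / norm x ^ 4 \<partial>lborel) =
      (\<integral>x. Re (euler f x * cnj (g x)) / norm x ^ 4 + Re (f x * cnj (euler g x)) / norm x ^ 4
        - 2 * (?p x / norm x ^ 4) \<partial>lborel)"
      by (simp add: add_divide_distrib diff_divide_distrib)
    also have "\<dots> = pairing (euler f) g + pairing f (euler g) - 2 * pairing f g"
      unfolding pairing_def
      by (simp only: Bochner_Integration.integral_diff Bochner_Integration.integral_add
          integral_mult_right_zero Bochner_Integration.integrable_add integrable_mult_right
          integrable_pairing f g punctured_tests_euler)
    finally show ?thesis .
  qed
  ultimately show ?thesis by simp
qed

text \<open>Apply the circle inequality to \<psi>-like restrictions of \<open>f\<close> to each
  circle about the origin, where the weight is constant, and average over rotations.\<close>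

lemma angular_pairing_inequality:
  assumes f: "f \<in> punctured_tests" and "a \<ge> 0" "C \<ge> 0"
    and C: "\<And>k::nat. C * (real k ^ 2 + a + 1) \<le> (real k ^ 2 + a - 1) ^ 2"
  defines "A \<equiv> \<lambda>x. of_real (1 - a) * f x + rotation (rotation f) x"
  shows "C * (pairing (rotation f) (rotation f) + (1 + a) * pairing f f) \<le> pairing A A"
proof -
  note [simp] = f punctured_tests_rotation[OF f] punctured_tests_rotation[OF punctured_tests_rotation[OF f]]
  have A [simp]: "A \<in> punctured_tests"
    unfolding A_def by (intro punctured_tests_add punctured_tests_cmult) simp_all
  let ?L = "rotation f"
  let ?q = "\<lambda>x. norm (A x) ^ 2 - C * (norm (?L x) ^ 2 + (1 + a) * norm (f x) ^ 2)"
  have cont: "continuous_on UNIV ?q"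
    by (intro continuous_intros continuous_on_punctured_tests) simp_all
  \<comment> \<open>A sum of norms vanishes only where every summand does, so its support contains
    that of \<open>?q\<close>.\<close>
  have "annular (\<lambda>x. norm (A x) + (norm (?L x) + norm (f x)))"
    by (intro annular_add; rule annular_mono[where f = A] annular_mono[where f = ?L] annular_mono[where f = f])
      (auto simp: test_functions_punctured[THEN iffD1])
  then have ann: "annular ?q"
    by (rule annular_mono) (auto simp: add_nonneg_eq_0_iff)
  then obtain R where R: "\<And>x. ?q x \<noteq> 0 \<Longrightarrow> norm x \<le> R"
    unfolding annular_def by blast
  have "integral {0..2*pi} (\<lambda>t. cmod (cis t) ^ 2 * (?q (cmul (cis t) x) / norm (cmul (cis t) x) ^ 4)) \<ge> 0" for x
  proof -
    let ?y = "\<lambda>t. cmul (cis t) x"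
    have c: "continuous_on S (\<lambda>z. g (cmul z x))" "continuous_on T (\<lambda>t. g (?y t))"
      if "g \<in> punctured_tests" for g S T
      by (rule continuous_on_compose2[OF continuous_on_punctured_tests[OF that, of UNIV]];
          auto intro!: continuous_intros)+
    have "C * (integral {0..2*pi} (\<lambda>t. norm (?L (?y t)) ^ 2) + (1 + a) * integral {0..2*pi} (\<lambda>t. norm (f (?y t)) ^ 2))
        \<le> integral {0..2*pi} (\<lambda>t. norm (A (?y t)) ^ 2)"
      unfolding A_def
      by (rule angular_inequality[where H = "\<lambda>z. f (cmul z x)" and ?H1.0 = "\<lambda>z. ?L (cmul z x)"])
        (use assms in \<open>auto intro!: c has_vector_derivative_rotation smooth_rotation
          simp: test_functions_punctured[THEN iffD1]\<close>)
    also have "integral {0..2*pi} (\<lambda>t. norm (A (?y t)) ^ 2) -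
        C * (integral {0..2*pi} (\<lambda>t. norm (?L (?y t)) ^ 2) + (1 + a) * integral {0..2*pi} (\<lambda>t. norm (f (?y t)) ^ 2))
        = integral {0..2*pi} (\<lambda>t. ?q (?y t))"
      by (intro integral_unique[symmetric] has_integral_diff has_integral_mult_right has_integral_add
          integrable_integral integrable_continuous_real continuous_intros c) simp_all
    finally have "0 \<le> integral {0..2*pi} (\<lambda>t. ?q (?y t)) / norm x ^ 4" by simp
    then show ?thesis by (simp add: norm_cmul)
  qed
  then have "0 \<le> (\<integral>x. integral {0..2*pi} (\<lambda>t. cmod (cis t) ^ 2 * (?q (cmul (cis t) x) / norm (cmul (cis t) x) ^ 4)) \<partial>lborel)"
    by (rule Bochner_Integration.integral_nonneg)
  also have "\<dots> = 2 * pi * (\<integral>x. ?q x / norm x ^ 4 \<partial>lborel)"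
    by (intro integral_cmul_average[where R = R] continuous_on_annular_div cont ann R continuous_intros) auto
  also have "(\<integral>x. ?q x / norm x ^ 4 \<partial>lborel) =
      pairing A A - C * (pairing ?L ?L + (1 + a) * pairing f f)"
  proof -
    have int: "integrable lborel (\<lambda>x. norm (g x) ^ 2 / norm x ^ 4)" if "g \<in> punctured_tests" for g
      using integrable_pairing[OF that that] by (simp add: complex_norm_square[symmetric])
    have "(\<integral>x. ?q x / norm x ^ 4 \<partial>lborel) = (\<integral>x. norm (A x) ^ 2 / norm x ^ 4 -
        C * (norm (?L x) ^ 2 / norm x ^ 4 + (1 + a) * (norm (f x) ^ 2 / norm x ^ 4)) \<partial>lborel)"
      by (intro Bochner_Integration.integral_cong refl)
        (simp add: add_divide_distrib diff_divide_distrib distrib_left)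
    also have "\<dots> = pairing A A - C * (pairing ?L ?L + (1 + a) * pairing f f)"
      unfolding pairing_self
      by (simp only: Bochner_Integration.integral_diff Bochner_Integration.integral_add
          integral_mult_right_zero Bochner_Integration.integrable_add integrable_mult_right
          int A f punctured_tests_rotation)
    finally show ?thesis .
  qed
  finally show ?thesis using pi_gt_zero by (simp add: zero_le_mult_iff)
qed

section \<open>Assembly of the Hardy-Rellich inequality\<close>

theorem corollary1p1:
  fixes a :: real and \<psi> :: "real^2 \<Rightarrow> complex"
  assumes "a \<ge> 0"
    and "\<psi> \<in> test_functions (UNIV - {0})"
  shows "(\<integral>x. norm (neg_laplacian_inv_square a \<psi> x) ^ 2 \<partial>lborel)
    \<ge> hardy_rellich_const a *
        ((\<integral>x. norm (gradient \<psi> x) ^ 2 / norm x ^ 2 \<partial>lborel)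
         + a * (\<integral>x. norm (\<psi> x) ^ 2 / norm x ^ 4 \<partial>lborel))"
proof -
  define C where "C = hardy_rellich_const a"
  define D where "D g = (\<lambda>x. euler g x + of_real (- 1) * g x)" for g :: "real^2 \<Rightarrow> complex"
  let ?L = rotation
  define A where "A = (\<lambda>x. of_real (1 - a) * \<psi> x + ?L (?L \<psi>) x)"
  have \<psi>: "\<psi> \<in> punctured_tests" by fact
  have smooth: "smooth g" if "g \<in> punctured_tests" for g
    using that by (simp add: test_functions_punctured)
  have D_in: "D g \<in> punctured_tests" if "g \<in> punctured_tests" for g
    unfolding D_def by (intro punctured_tests_add punctured_tests_cmult punctured_tests_euler that)
  note L_in = punctured_tests_rotation
  have A_in: "A \<in> punctured_tests"
    unfolding A_def by (intro punctured_tests_add punctured_tests_cmult L_in \<psi>)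
  note in_V [simp] = \<psi> D_in L_in A_in punctured_tests_add punctured_tests_cmult

  have D_anti: "pairing (D f) g = - pairing f (D g)"
    if "f \<in> punctured_tests" "g \<in> punctured_tests" for f g
  proof -
    have "pairing (D f) g = pairing (euler f) g + (- 1) * pairing f g"
      unfolding D_def using that
      by (subst pairing_add) (simp_all only: pairing_scale in_V punctured_tests_euler)
    moreover have "pairing (D g) f = pairing (euler g) f + (- 1) * pairing g f"
      unfolding D_def using that
      by (subst pairing_add) (simp_all only: pairing_scale in_V punctured_tests_euler)
    ultimately show ?thesis
      using pairing_euler[OF that] pairing_commute[of g f] pairing_commute[of "D g" f]
        pairing_commute[of "euler g" f] by simp
  qed
  have D_L: "D (?L g) = ?L (D g)" if "g \<in> punctured_tests" for g
    using smooth[OF that]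
    by (simp only: D_def fun_eq_iff euler_rotation_commute rotation_add smooth_euler smooth_cmult
        rotation_cmult simp_thms)
  have D_self: "pairing (D g) g = 0" if "g \<in> punctured_tests" for g
    using D_anti[OF that that] pairing_commute[of g "D g"] by simp

  \<comment> \<open>Cross terms: skew-symmetry moves one factor across, commutation of
    \<open>D\<close> with \<open>rotation\<close> rearranges the rest, and \<open>D_self\<close>
    kills the odd ones.\<close>
  have DD_f: "pairing (D (D \<psi>)) \<psi> = - pairing (D \<psi>) (D \<psi>)"
    by (rule D_anti) simp_all
  have DD_LL: "pairing (D (D \<psi>)) (?L (?L \<psi>)) = pairing (D (?L \<psi>)) (D (?L \<psi>))"
  proof -
    have "pairing (D (D \<psi>)) (?L (?L \<psi>)) = - pairing (D \<psi>) (D (?L (?L \<psi>)))"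
      by (rule D_anti) simp_all
    also have "D (?L (?L \<psi>)) = ?L (?L (D \<psi>))"
      by (simp only: D_L in_V)
    also have "- pairing (D \<psi>) (?L (?L (D \<psi>))) = pairing (?L (D \<psi>)) (?L (D \<psi>))"
      using pairing_rotation[of "D \<psi>" "?L (D \<psi>)"] by simp
    finally show ?thesis by (simp only: D_L in_V)
  qed
  have D_LL: "pairing (D \<psi>) (?L (?L \<psi>)) = 0"
  proof -
    have "pairing (D \<psi>) (?L (?L \<psi>)) = - pairing (?L (D \<psi>)) (?L \<psi>)"
      using pairing_rotation[of "D \<psi>" "?L \<psi>"] by simp
    also have "?L (D \<psi>) = D (?L \<psi>)"
      by (simp only: D_L in_V)
    finally show ?thesis using D_self[of "?L \<psi>"] by simp
  qed

  \<comment> \<open>\<open>F\<close> is minus \<open>norm x ^ 2\<close> times the operator applied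
    to \<open>\<psi>\<close>, with \<open>euler\<close> replaced by \<open>D\<close> plus the
    identity.\<close>
  define F where "F = (\<lambda>x. D (D \<psi>) x + (of_real 2 * D \<psi> x + A x))"
  have F: "norm (neg_laplacian_inv_square a \<psi> x) ^ 2 = norm (F x) ^ 2 / norm x ^ 4" for x
  proof (cases "x = 0")
    case True
    \<comment> \<open>At the origin the right side is 0 by the convention for division by zero; on
      the left the potential term is 0 for the same reason, and the Laplacian vanishes off the
      support.\<close>
    have "annular (pderivative i (pderivative i \<psi>))" for i
      using \<psi> by (auto simp: test_functions_punctured intro: annular_pderivative)
    then have "pderivative i (pderivative i \<psi>) 0 = 0" for i
      unfolding annular_def by (metis norm_zero not_less)
    then show ?thesis
      using True by (simp add: neg_laplacian_inv_square_def laplacian_def)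
  next
    case False
    have "D (D \<psi>) x = euler (euler \<psi>) x - 2 * euler \<psi> x + \<psi> x"
      unfolding D_def using smooth[OF \<psi>]
      by (simp only: euler_add euler_cmult smooth_euler smooth_cmult) simp
    then have "F x = euler (euler \<psi>) x + ?L (?L \<psi>) x - of_real a * \<psi> x"
      unfolding F_def A_def by (simp add: D_def algebra_simps)
    also have "\<dots> = - (of_real (norm x ^ 2) * neg_laplacian_inv_square a \<psi> x)"
      using False unfolding polar_laplacian[OF smooth[OF \<psi>], symmetric] neg_laplacian_inv_square_def
      by (simp add: field_simps)
    finally have "norm (F x) ^ 2 = norm x ^ 4 * norm (neg_laplacian_inv_square a \<psi> x) ^ 2"
      by (simp add: norm_mult norm_power power_mult_distrib)
    then show ?thesis using False by simp
  qed
  have G: "norm (gradient \<psi> x) ^ 2 / norm x ^ 2 =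
      Re (euler \<psi> x * cnj (euler \<psi> x)) / norm x ^ 4 + Re (?L \<psi> x * cnj (?L \<psi> x)) / norm x ^ 4" for x
  proof (cases "x = 0")
    case False
    then show ?thesis
      using polar_gradient[of x \<psi>]
      by (simp add: complex_norm_square[symmetric] divide_simps) (simp add: power4_eq_xxxx power2_eq_square mult_ac)
  qed simp

  have "pairing F F = pairing (D (D \<psi>)) (D (D \<psi>)) + 4 * pairing (D \<psi>) (D \<psi>) + pairing A A
      + 4 * pairing (D (D \<psi>)) (D \<psi>) + 2 * pairing (D (D \<psi>)) A + 4 * pairing (D \<psi>) A"
  proof -
    have left: "pairing F g = pairing (D (D \<psi>)) g + 2 * pairing (D \<psi>) g + pairing A g"
      if "g \<in> punctured_tests" for g
      unfolding F_def using that
      by (simp only: pairing_add pairing_scale in_V)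
    have "F \<in> punctured_tests" unfolding F_def by simp
    from left[OF this] show ?thesis
      using left[OF D_in[OF D_in[OF \<psi>]]] left[OF D_in[OF \<psi>]] left[OF A_in]
        pairing_commute[of F "D (D \<psi>)"] pairing_commute[of F "D \<psi>"] pairing_commute[of F A]
        pairing_commute[of "D \<psi>" "D (D \<psi>)"] pairing_commute[of A "D (D \<psi>)"]
        pairing_commute[of A "D \<psi>"]
      by linarith
  qed
  moreover have "pairing g A = (1 - a) * pairing g \<psi> + pairing g (?L (?L \<psi>))"
    if "g \<in> punctured_tests" for g
  proof -
    have "pairing A g = (1 - a) * pairing \<psi> g + pairing (?L (?L \<psi>)) g"
      unfolding A_def using that by (simp only: pairing_add pairing_scale in_V)
    then show ?thesis by (simp only: pairing_commute[of _ g])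
  qed
  \<comment> \<open>The coefficient \<open>2 * a + 2\<close> is 4 from the square of
    \<open>2 * D \<psi>\<close> plus \<open>- 2 * (1 - a)\<close> from pairing
    \<open>D (D \<psi>)\<close> with the zeroth-order part of \<open>A\<close>.\<close>
  ultimately have LHS: "pairing F F = pairing (D (D \<psi>)) (D (D \<psi>)) + (2 * a + 2) * pairing (D \<psi>) (D \<psi>)
      + 2 * pairing (D (?L \<psi>)) (D (?L \<psi>)) + pairing A A"
    by (simp add: D_self DD_f DD_LL D_LL) (simp add: algebra_simps)

  have euler_D: "euler \<psi> = (\<lambda>x. D \<psi> x + \<psi> x)" by (simp add: D_def)
  \<comment> \<open>Pythagoras, as \<open>D \<psi>\<close> and \<open>\<psi>\<close> are
    orthogonal.\<close>
  have RHS: "pairing (euler \<psi>) (euler \<psi>) = pairing (D \<psi>) (D \<psi>) + pairing \<psi> \<psi>"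
  proof -
    have "pairing (euler \<psi>) g = pairing (D \<psi>) g + pairing \<psi> g" if "g \<in> punctured_tests" for g
      unfolding euler_D using that by (intro pairing_add) simp_all
    from this[OF punctured_tests_euler[OF \<psi>]] this[OF D_in[OF \<psi>]] this[OF \<psi>] show ?thesis
      using pairing_commute[of "D \<psi>" "euler \<psi>"] pairing_commute[of \<psi> "euler \<psi>"]
        pairing_commute[of \<psi> "D \<psi>"] D_self[OF \<psi>]
      by linarith
  qed

  have min: "C \<le> (real k ^ 2 + a - 1) ^ 2 / (real k ^ 2 + a + 1)" for k
    using hardy_rellich_const_is_minimum(2)[OF \<open>a \<ge> 0\<close>, of k] by (simp add: C_def hardy_rellich_ratio_def)
  then have modes: "C * (real k ^ 2 + a + 1) \<le> (real k ^ 2 + a - 1) ^ 2" for k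
    using \<open>a \<ge> 0\<close> by (subst pos_le_divide_eq[symmetric]) (auto intro: add_nonneg_pos)
  have "C \<ge> 0"
    using hardy_rellich_const_is_minimum(1)[OF \<open>a \<ge> 0\<close>] \<open>a \<ge> 0\<close>
    by (auto simp: C_def hardy_rellich_ratio_def)
  \<comment> \<open>The mode \<open>k = 0\<close> gives \<open>(a - 1) ^ 2\<close> as a bound, which
    is at most \<open>(a + 1) ^ 2\<close> because \<open>a\<close> is nonnegative.\<close>
  have "C * (a + 1) \<le> (a + 1) * (a + 1)"
    using modes[of 0] \<open>a \<ge> 0\<close> by (simp add: power2_eq_square algebra_simps)
  then have "C \<le> a + 1" using \<open>a \<ge> 0\<close> by (simp add: mult_le_cancel_right)
  then have "C * pairing (D \<psi>) (D \<psi>) \<le> (2 * a + 2) * pairing (D \<psi>) (D \<psi>)"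
    using \<open>a \<ge> 0\<close> by (intro mult_right_mono pairing_self_nonneg) simp
  moreover have "C * (pairing (?L \<psi>) (?L \<psi>) + (1 + a) * pairing \<psi> \<psi>) \<le> pairing A A"
    unfolding A_def by (intro angular_pairing_inequality \<psi> \<open>a \<ge> 0\<close> \<open>C \<ge> 0\<close> modes)
  \<comment> \<open>The squares of \<open>D (D \<psi>)\<close> and
    \<open>D (rotation \<psi>)\<close> in \<open>LHS\<close> are nonnegative and are
    dropped.\<close>
  ultimately have "C * (pairing (euler \<psi>) (euler \<psi>) + pairing (?L \<psi>) (?L \<psi>) + a * pairing \<psi> \<psi>) \<le> pairing F F"
    unfolding LHS RHS
    using pairing_self_nonneg[of "D (D \<psi>)"] pairing_self_nonneg[of "D (?L \<psi>)"]
    by (simp add: algebra_simps)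
  also have "pairing F F = (\<integral>x. norm (neg_laplacian_inv_square a \<psi> x) ^ 2 \<partial>lborel)"
    unfolding pairing_self F ..
  also have "pairing (euler \<psi>) (euler \<psi>) + pairing (?L \<psi>) (?L \<psi>) = (\<integral>x. norm (gradient \<psi> x) ^ 2 / norm x ^ 2 \<partial>lborel)"
    unfolding G pairing_def
    by (intro Bochner_Integration.integral_add[symmetric] integrable_pairing punctured_tests_euler L_in \<psi>)
  finally show ?thesis
    unfolding C_def pairing_self[of \<psi>] .
qed

end
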